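(* Let $\mathcal X$ and $\mathcal Y$ be the complex $*$-algebras described in the context. Then for every real $\alpha>0$ and all $l,m\in\mathbb Z_{\ge0}$ the following identity holds in $\mathcal X\otimes\mathcal Y$: $$ \begin{aligned} &R^{(\alpha)}_{l,m}\bigl(-qX_1\otimes Y_1^{*}+X_2\otimes Y_2,\;-qX_1^{*}\otimes Y_1+X_2^{*}\otimes Y_2^{*},\;Q\otimes D;\,q^2\bigr)\\ &=\sum_{r=0}^{l}\sum_{s=0}^{m} c^{(\alpha)}_{l,m;r,s}\; R^{(\alpha+r+s)}_{l-r,m-s}(X_2,X_2^*,Q;q^2)\,R^{(\alpha-1)}_{r,s}(X_1,X_1^*,Q-X_2X_2^*;q^2)\\ &\qquad\qquad\otimes (-q)^{r-s}\,R^{(\alpha+r+s)}_{l-r,m-s}(Y_2,Y_2^*,D;q^2)\,Y_1^{s}(Y_1^* )^{r}. \end{aligned} $$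
   Context: Fix $0<q<1$. For $a\in\mathbb C$ and $k\in\mathbb Z_{\ge0}$, $(a;p)_k=\prod_{j=0}^{k-1}(1-ap^j)$. $\mathcal X$ is the unital complex $*$-algebra generated by $X_1,X_1^*,X_2,X_2^*,Q$ with involution $(X_i)^*=X_i^*$, $Q^*=Q$, subject to the relations: $X_1X_2=qX_2X_1$, $X_1^*X_2=qX_2X_1^*$, $X_2^*X_2=q^2X_2X_2^*+(1-q^2)Q$, $X_1^*X_1=q^2X_1X_1^*+(1-q^2)(Q-X_2X_2^* )$, and $Q$ is central (together with the relations obtained by applying $*$). $\mathcal Y$ is the unital complex $*$-algebra generated by $Y_1,Y_1^*,Y_2,Y_2^*,D$ with involution $(Y_i)^*=Y_i^*$, $D^*=D$, subject to: $Y_1Y_2=qY_2Y_1$, $Y_1^*Y_2=qY_2Y_1^*$, $Y_1Y_1^*=Y_1^*Y_1$, $D=Y_1Y_1^*+Y_2Y_2^*=q^2Y_1^*Y_1+Y_2^*Y_2$ (and their $*$-images). Generalized $q$-disk polynomials: for $\alpha>-1$, $l,m\in\mathbb Z_{\ge0}$, a base $p\in(0,1)$, and elements $A,B,C$ of an algebra such that $C$ commutes with $A$ and $B$, define $R^{(\alpha)}_{l,m}(A,B,C;p)=\sum_{k=0}^{m}\frac{(p^{-m};p)_k(p^{\alpha+l+1};p)_k}{(p^{\alpha+1};p)_k(p;p)_k}p^k\,C^{m-k}A^{l-m}(C-AB)^k$ if $l\ge m$, and $R^{(\alpha)}_{l,m}(A,B,C;p)=\sum_{k=0}^{l}\frac{(p^{-l};p)_k(p^{\alpha+m+1};p)_k}{(p^{\alpha+1};p)_k(p;p)_k}p^k\,C^{l-k}(C-AB)^kB^{m-l}$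 if $l\le m$ (formally $C^mA^{l-m}P^{(\alpha,l-m)}_m((C-AB)/C;p)$ resp. $C^lP^{(\alpha,m-l)}_l((C-AB)/C;p)B^{m-l}$ with little $q$-Jacobi polynomials $P^{(\alpha,\beta)}_m(x;p)=\sum_{k=0}^m\frac{(p^{-m};p)_k(p^{\alpha+\beta+m+1};p)_k}{(p^{\alpha+1};p)_k(p;p)_k}(px)^k$). In every instance in the claim the third argument commutes with the first two. Constants: $c^{(\alpha)}_{l,m}=\frac{(1-q^{2(\alpha+1)})q^{2m(\alpha+1)}}{1-q^{2(\alpha+l+m+1)}}\cdot\frac{(q^2;q^2)_l(q^2;q^2)_m}{(q^{2(\alpha+1)};q^2)_l(q^{2(\alpha+1)};q^2)_m}$ and $c^{(\alpha)}_{l,m;r,s}=\frac{1-q^{2(\alpha+r+s+1)}}{1-q^{2(\alpha+1)}}\cdot\frac{c^{(\alpha)}_{l,m}}{c^{(\alpha+r+s)}_{l-r,m-s}\,c^{(\alpha-1)}_{r,s}}$. *)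

theory Defs
  imports Complex_Main
begin

definition qpoch :: "real \<Rightarrow> real \<Rightarrow> nat \<Rightarrow> real" where
  "qpoch a p k = (\<Prod>j<k. (1 - a * p ^ j))"

text \<open>Coefficient of the k-th summand of the little q-Jacobi type sum:
  ((p^{-n};p)_k (p^{alpha+N+1};p)_k / ((p^{alpha+1};p)_k (p;p)_k)) p^k,
  with n = min l m and N = max l m.\<close>
definition Rcoef :: "real \<Rightarrow> nat \<Rightarrow> nat \<Rightarrow> real \<Rightarrow> nat \<Rightarrow> real" where
  "Rcoef alpha n N p k =
     qpoch (p powr (- real n)) p k * qpoch (p powr (alpha + real N + 1)) p k
     / (qpoch (p powr (alpha + 1)) p k * qpoch p p k) * p ^ k"

definition Rdisk :: "real \<Rightarrow> nat \<Rightarrow> nat \<Rightarrow> 'a::real_algebra_1 \<Rightarrow> 'a \<Rightarrow> 'a \<Rightarrow> real \<Rightarrow> 'a" where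
  "Rdisk alpha l m A B C p =
     (if m \<le> l then
        (\<Sum>k=0..m. of_real (Rcoef alpha m l p k) * C ^ (m - k) * A ^ (l - m) * (C - A * B) ^ k)
      else
        (\<Sum>k=0..l. of_real (Rcoef alpha l m p k) * C ^ (l - k) * (C - A * B) ^ k * B ^ (m - l)))"

definition cc :: "real \<Rightarrow> real \<Rightarrow> nat \<Rightarrow> nat \<Rightarrow> real" where
  "cc q alpha l m =
     (1 - q powr (2 * (alpha + 1))) * q powr (2 * real m * (alpha + 1))
       / (1 - q powr (2 * (alpha + real l + real m + 1)))
     * (qpoch (q^2) (q^2) l * qpoch (q^2) (q^2) m)
       / (qpoch (q powr (2 * (alpha + 1))) (q^2) l * qpoch (q powr (2 * (alpha + 1))) (q^2) m)"

definition cc4 :: "real \<Rightarrow> real \<Rightarrow> nat \<Rightarrow> nat \<Rightarrow> nat \<Rightarrow> nat \<Rightarrow> real" where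
  "cc4 q alpha l m r s =
     (1 - q powr (2 * (alpha + real r + real s + 1))) / (1 - q powr (2 * (alpha + 1)))
     * cc q alpha l m
       / (cc q (alpha + real r + real s) (l - r) (m - s) * cc q (alpha - 1) r s)"

text \<open>Defining relations of the algebra X (including their *-images).\<close>
definition X_rels :: "real \<Rightarrow> 'a::real_algebra_1 \<Rightarrow> 'a \<Rightarrow> 'a \<Rightarrow> 'a \<Rightarrow> 'a \<Rightarrow> bool" where
  "X_rels q x1 x1s x2 x2s Q \<longleftrightarrow>
     x1 * x2 = of_real q * (x2 * x1) \<and>
     x2s * x1s = of_real q * (x1s * x2s) \<and>
     x1s * x2 = of_real q * (x2 * x1s) \<and>
     x2s * x1 = of_real q * (x1 * x2s) \<and>
     x2s * x2 = of_real (q^2) * (x2 * x2s) + of_real (1 - q^2) * Q \<and>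
     x1s * x1 = of_real (q^2) * (x1 * x1s) + of_real (1 - q^2) * (Q - x2 * x2s) \<and>
     (\<forall>z\<in>{x1, x1s, x2, x2s}. Q * z = z * Q)"

text \<open>Defining relations of the algebra Y (including their *-images).\<close>
definition Y_rels :: "real \<Rightarrow> 'a::real_algebra_1 \<Rightarrow> 'a \<Rightarrow> 'a \<Rightarrow> 'a \<Rightarrow> 'a \<Rightarrow> bool" where
  "Y_rels q y1 y1s y2 y2s D \<longleftrightarrow>
     y1 * y2 = of_real q * (y2 * y1) \<and>
     y2s * y1s = of_real q * (y1s * y2s) \<and>
     y1s * y2 = of_real q * (y2 * y1s) \<and>
     y2s * y1 = of_real q * (y1 * y2s) \<and>
     y1 * y1s = y1s * y1 \<and>
     D = y1 * y1s + y2 * y2s \<and>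
     D = of_real (q^2) * (y1s * y1) + y2s * y2"

end

(*
  Multiplying R_{l,m}(A,B,C) by A on the left gives a three-term recurrence that expresses
  R_{l+1,m} through R_{l,m} and R_{l,m-1}; the addition formula follows by induction on l once
  the right-hand side satisfies the same recurrence. To see this, multiply a term of the sum by
  X2 (x) Y2 - q X1 (x) Y1*. In each tensor factor the result is a combination of
  R^(alpha+r+s)_{j+1,k} and C R^(alpha+r+s)_{j,k-1}, by the same recurrence, by the connection
  formula from the parameter beta to beta + 1, or by the formula that absorbs the factor C - AB
  while lowering beta. Each contribution is a "square" V(a,b) with the same combination in both
  tensor factors, so comparing coefficients leaves three rational identities for every term.
  The case l = 0 is a q-binomial theorem.
*)
theory Submission
  imports Defs
begin

section \<open>Contiguous relations of the coefficients\<close>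

text \<open>The left-hand side never has to be expanded: its three arguments satisfy the same
  relations \<open>qdisk\<close> as the triples built from X2 and Y2, so the recurrence holds for it
  with no further work. The same abstraction gives X2 and Y2 identical scalars, and this is why
  every contribution is a square. The obstacle is the parameter alpha + r + s, which is tied to the
  indices. X2 (x) Y2 leaves r and s alone, but X1 (x) Y1* moves r to r + 1 or s to s - 1, and then
  the disk polynomials in X2 and Y2 carry a parameter that is too small or too large by one. The
  first mismatch is repaired by the connection formula. The second can be repaired because the move
  to s - 1 also produces Q - X2 X2* in one factor and Y1 Y1* = D - Y2 Y2* in the other, the very
  defects that lowering the parameter absorbs. Of the three rational identities, two reproduce the
  scalars of the recurrence; the third makes the mixed tensors cancel, which have no counterpart in
  it. The denominators depend on l + m only, so the scalars leave the double sum.\<close>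

lemma qpoch_0 [simp]: "qpoch a p 0 = 1"
  by (simp add: qpoch_def)

section \<open>Shifts and signs of q-Pochhammer symbols\<close>

lemma qpoch_Suc: "qpoch a p (Suc k) = qpoch a p k * (1 - a * p ^ k)"
  by (simp add: qpoch_def)

lemma qpoch_Suc_shift: "qpoch a p (Suc k) = (1 - a) * qpoch (a * p) p k"
  unfolding qpoch_def by (subst prod.lessThan_Suc_shift) (simp add: mult.assoc)

lemma qpoch_shift: "(1 - a) * qpoch (a * p) p k = qpoch a p k * (1 - a * p ^ k)"
  by (metis qpoch_Suc qpoch_Suc_shift)

lemma mult_power_less_one:
  fixes a p :: real
  assumes "0 < p" "p < 1" "0 < a" "a < 1"
  shows "a * p ^ k < 1"
  using mult_less_le_imp_less[of a 1 "p ^ k" 1] assms by (auto simp: power_le_one)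

lemma qpoch_pos:
  assumes "0 < p" "p < 1" "0 < a" "a < 1"
  shows "0 < qpoch a p k"
  unfolding qpoch_def using mult_power_less_one[OF assms] by (intro prod_pos) (auto simp: algebra_simps)

lemma qpoch_inverse_power_eq_0:
  assumes "0 < p" "n < k"
  shows "qpoch (1 / p ^ n) p k = 0"
  unfolding qpoch_def using assms by (auto intro!: bexI[of _ n])

text \<open>
  With \<open>x\<close>, \<open>u\<close>, \<open>v\<close> standing for the powers of \<open>p\<close> with exponents \<open>\<beta> + 1\<close>, \<open>n\<close>, \<open>N\<close>,
  changes of the parameters become multiplications by \<open>p\<close> and all contiguous relations
  become rational identities.
\<close>

definition jcoef :: "real \<Rightarrow> real \<Rightarrow> real \<Rightarrow> real \<Rightarrow> nat \<Rightarrow> real" where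
  "jcoef p x u v k =
     qpoch (1 / u) p k * qpoch (x * v) p k / (qpoch x p k * qpoch p p k) * p ^ k"

lemma Rcoef_eq_jcoef:
  assumes "0 < p"
  shows "Rcoef \<beta> n N p k = jcoef p (p powr (\<beta> + 1)) (p ^ n) (p ^ N) k"
proof -
  have "p powr (\<beta> + real N + 1) = p powr (\<beta> + 1) * p ^ N"
    using assms by (simp add: powr_add powr_realpow)
  moreover have "p powr (- real n) = 1 / p ^ n"
    using assms by (simp add: powr_minus powr_realpow divide_simps)
  ultimately show ?thesis
    by (simp add: Rcoef_def jcoef_def)
qed

lemma jcoef_0 [simp]: "jcoef p x u v 0 = 1"
  by (simp add: jcoef_def)

lemma jcoef_eq_0: "0 < p \<Longrightarrow> n < k \<Longrightarrow> jcoef p x (p ^ n) v k = 0"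
  by (simp add: jcoef_def qpoch_inverse_power_eq_0)

lemma jcoef_Suc:
  "jcoef p x u v (Suc k) =
     jcoef p x u v k * ((1 - p ^ k / u) * (1 - x * v * p ^ k) * p / ((1 - x * p ^ k) * (1 - p * p ^ k)))"
  by (simp add: jcoef_def qpoch_Suc mult_ac)

lemma jcoef_shift_x:
  assumes "x \<noteq> 1" "x * v \<noteq> 1"
  shows "jcoef p (x * p) u v k =
     jcoef p x u v k * ((1 - x * v * p ^ k) * (1 - x) / ((1 - x * v) * (1 - x * p ^ k)))"
proof -
  have "qpoch (x * p) p k = qpoch x p k * (1 - x * p ^ k) / (1 - x)"
    using qpoch_shift[of x p k] assms by (simp add: field_simps)
  moreover have "qpoch (x * p * v) p k = qpoch (x * v) p k * (1 - x * v * p ^ k) / (1 - x * v)"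
    using qpoch_shift[of "x * v" p k] assms by (simp add: field_simps)
  ultimately show ?thesis by (simp add: jcoef_def mult_ac)
qed

lemma jcoef_shift_v:
  assumes "x * v \<noteq> 1"
  shows "jcoef p x u (v * p) k = jcoef p x u v k * ((1 - x * v * p ^ k) / (1 - x * v))"
proof -
  have "qpoch (x * (v * p)) p k = qpoch (x * v) p k * (1 - x * v * p ^ k) / (1 - x * v)"
    using qpoch_shift[of "x * v" p k] assms by (simp add: field_simps)
  then show ?thesis by (simp add: jcoef_def mult_ac)
qed

lemma jcoef_shift_u:
  assumes "u \<noteq> 1" "u \<noteq> 0" "p \<noteq> 0"
  shows "jcoef p x (u / p) v k = jcoef p x u v k * ((1 - p ^ k / u) / (1 - 1 / u))"
proof -
  have "qpoch (1 / (u / p)) p k = qpoch (1 / u) p k * (1 - p ^ k / u) / (1 - 1 / u)"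
    using qpoch_shift[of "1 / u" p k] assms by (simp add: nonzero_eq_divide_eq mult_ac)
  then show ?thesis by (simp add: jcoef_def mult_ac)
qed

lemma jcoef_Suc_shift_u:
  assumes "p \<noteq> 0"
  shows "jcoef p x (u * p) v (Suc k) =
     jcoef p x u v k * ((1 - 1 / (u * p)) * (1 - x * v * p ^ k) * p / ((1 - x * p ^ k) * (1 - p * p ^ k)))"
proof -
  have "qpoch (1 / (u * p)) p (Suc k) = (1 - 1 / (u * p)) * qpoch (1 / u) p k"
    using qpoch_Suc_shift[of "1 / (u * p)" p k] assms by simp
  then show ?thesis by (simp add: jcoef_def qpoch_Suc mult_ac)
qed

lemma jcoef_Suc_shift_v:
  assumes "p \<noteq> 0"
  shows "jcoef p x u (v / p) (Suc k) =
     jcoef p x u v k * ((1 - p ^ k / u) * (1 - x * v / p) * p / ((1 - x * p ^ k) * (1 - p * p ^ k)))"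
proof -
  have "qpoch (x * (v / p)) p (Suc k) = (1 - x * v / p) * qpoch (x * v) p k"
    using qpoch_Suc_shift[of "x * (v / p)" p k] assms by simp
  then show ?thesis by (simp add: jcoef_def qpoch_Suc mult_ac)
qed

lemma jcoef_shift_xv:
  assumes "x \<noteq> 1" "p \<noteq> 0"
  shows "jcoef p (x * p) u (v / p) k = jcoef p x u v k * ((1 - x) / (1 - x * p ^ k))"
proof -
  have "qpoch (x * p) p k = qpoch x p k * (1 - x * p ^ k) / (1 - x)"
    using qpoch_shift[of x p k] assms by (simp add: field_simps)
  then show ?thesis using assms by (simp add: jcoef_def mult_ac)
qed

section \<open>Four contiguous relations of the little q-Jacobi coefficients\<close>

lemma mult_less_one:
  fixes a b :: real
  assumes "0 < a" "a < 1" "0 < b" "b \<le> 1"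
  shows "a * b < 1"
  using mult_left_mono[of b 1 a] assms by linarith

text \<open>Source of the connection formula from beta to beta + 1. Shifting a parameter by p
  changes only the end factors of a q-Pochhammer symbol, so after division by the common coefficient
  \<open>G\<close> a rational identity in x, u, v and \<open>h\<close> remains; the next three
  proofs follow the same pattern. The strict bound on u excludes degree 0, where 1 - 1 / u would be
  a vanishing denominator.\<close>

lemma jcoef_raise:
  assumes "0 < p" "p < 1" "0 < x" "x < 1" "0 < u" "u < 1" "0 < v" "v < 1"
  shows "jcoef p x u v k =
     (1 - x * u) * (1 - x * v) / ((1 - x * u * v) * (1 - x)) * jcoef p (x * p) u v k
     - x * (1 - u) * (1 - v) / ((1 - x * u * v) * (1 - x)) * jcoef p (x * p) (u / p) (v / p) k"
proof -
  define h where "h = p ^ k"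
  define G where "G = jcoef p x u v k"
  have ne: "x \<noteq> 1" "x * v \<noteq> 1" "x * u \<noteq> 1" "x * u * v \<noteq> 1" "x * h \<noteq> 1" "u \<noteq> 1" "u \<noteq> 0"
    using assms mult_power_less_one[of p x k] mult_less_one[of x u] mult_less_one[of x v]
      mult_less_one[of "x * u" v] by (auto simp: h_def)
  have 1: "jcoef p (x * p) u v k = G * ((1 - x * v * h) * (1 - x) / ((1 - x * v) * (1 - x * h)))"
    unfolding G_def h_def using ne by (intro jcoef_shift_x) auto
  have 2: "jcoef p (x * p) (u / p) (v / p) k
      = G * (((1 - x) / (1 - x * h)) * ((1 - h / u) / (1 - 1 / u)))"
    unfolding G_def h_def using ne assms by (simp add: jcoef_shift_u jcoef_shift_xv)
  have "1 = (1 - x * u) * (1 - x * v) / ((1 - x * u * v) * (1 - x)) *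
       ((1 - x * v * h) * (1 - x) / ((1 - x * v) * (1 - x * h)))
     - x * (1 - u) * (1 - v) / ((1 - x * u * v) * (1 - x)) *
       (((1 - x) / (1 - x * h)) * ((1 - h / u) / (1 - 1 / u)))"
    using ne by (simp add: divide_simps) algebra
  moreover have "\<And>c A d B :: real. 1 = c * A - d * B \<Longrightarrow> G = c * (G * A) - d * (G * B)"
    by algebra
  ultimately show ?thesis
    unfolding 1 2 G_def[symmetric] by blast
qed

text \<open>For l >= m, multiplication by A only lengthens the power A^(l-m), so the recurrence is a
  relation between the polynomial parts. Here u belongs to the smaller index m and v to the larger
  index l.\<close>

lemma jcoef_left_ge:
  assumes "0 < p" "p < 1" "0 < x" "x < 1" "0 < u" "u < 1" "0 < v" "v \<le> 1"
  shows "jcoef p x u v k =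
     (1 - x * v) / (1 - x * u * v) * jcoef p x u (v * p) k
     + x * v * (1 - u) / (1 - x * u * v) * jcoef p x (u / p) v k"
proof -
  define h where "h = p ^ k"
  define G where "G = jcoef p x u v k"
  have ne: "x \<noteq> 1" "x * v \<noteq> 1" "x * u \<noteq> 1" "x * u * v \<noteq> 1" "x * h \<noteq> 1" "u \<noteq> 1" "u \<noteq> 0"
    using assms mult_power_less_one[of p x k] mult_less_one[of x u] mult_less_one[of x v]
      mult_less_one[of "x * u" v] by (auto simp: h_def)
  have 1: "jcoef p x u (v * p) k = G * ((1 - x * v * h) / (1 - x * v))"
    unfolding G_def h_def using ne by (intro jcoef_shift_v) auto
  have 2: "jcoef p x (u / p) v k = G * ((1 - h / u) / (1 - 1 / u))"
    unfolding G_def h_def using ne assms by (simp add: jcoef_shift_u)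
  have "1 = (1 - x * v) / (1 - x * u * v) * ((1 - x * v * h) / (1 - x * v))
     + x * v * (1 - u) / (1 - x * u * v) * ((1 - h / u) / (1 - 1 / u))"
    using ne by (simp add: divide_simps) algebra
  moreover have "\<And>c A d B :: real. 1 = c * A + d * B \<Longrightarrow> G = c * (G * A) + d * (G * B)"
    by algebra
  ultimately show ?thesis
    unfolding 1 2 G_def[symmetric] by blast
qed

text \<open>For l < m, pulling A through W^k costs p^(-k), and A then meets a factor B as A B = C -
  W. This explains the powers of p in the denominators and the difference of consecutive
  coefficients. The constant term is not covered and is treated separately in
  \<open>dpoly_left_le\<close>.\<close>

lemma jcoef_left_le:
  assumes "0 < p" "p < 1" "0 < x" "x < 1" "0 < u" "u \<le> 1" "0 < v" "v \<le> 1"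
  shows "jcoef p x u v (Suc k) / p ^ Suc k - jcoef p x u v k / p ^ k =
     (1 - x * u) / (1 - x * u * v) * jcoef p x (u * p) v (Suc k)
     + x * u * (1 - v) / (1 - x * u * v) * jcoef p x u (v / p) (Suc k)"
proof -
  define h where "h = p ^ k"
  define G where "G = jcoef p x u v k"
  have ne: "x \<noteq> 1" "x * v \<noteq> 1" "x * u \<noteq> 1" "x * u * v \<noteq> 1" "x * h \<noteq> 1" "u \<noteq> 0" "p * h \<noteq> 1" "h \<noteq> 0" "p \<noteq> 0"
    using assms mult_power_less_one[of p x k] mult_less_one[of x u] mult_less_one[of x v]
      mult_less_one[of "x * u" v] mult_power_less_one[of p p k] by (auto simp: h_def)
  have 1: "jcoef p x u v (Suc k) = G * ((1 - h / u) * (1 - x * v * h) * p / ((1 - x * h) * (1 - p * h)))"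
    unfolding G_def h_def by (rule jcoef_Suc)
  have 2: "jcoef p x (u * p) v (Suc k) = G * ((1 - 1 / (u * p)) * (1 - x * v * h) * p / ((1 - x * h) * (1 - p * h)))"
    unfolding G_def h_def using ne by (intro jcoef_Suc_shift_u) auto
  have 3: "jcoef p x u (v / p) (Suc k) = G * ((1 - h / u) * (1 - x * v / p) * p / ((1 - x * h) * (1 - p * h)))"
    unfolding G_def h_def using ne by (intro jcoef_Suc_shift_v) auto
  have "((1 - h / u) * (1 - x * v * h) * p / ((1 - x * h) * (1 - p * h))) / (p * h) - 1 / h =
    (1 - x * u) / (1 - x * u * v) * ((1 - 1 / (u * p)) * (1 - x * v * h) * p / ((1 - x * h) * (1 - p * h)))
    + x * u * (1 - v) / (1 - x * u * v) * ((1 - h / u) * (1 - x * v / p) * p / ((1 - x * h) * (1 - p * h)))"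
    using ne by (simp add: divide_simps) algebra
  moreover have "G * t / y - G / h = c * (G * A) + d * (G * B)"
    if "t / y - 1 / h = c * A + d * B" for t y c A d B
  proof -
    have "G * t / y - G / h = G * (t / y - 1 / h)"
      by (simp add: right_diff_distrib)
    then show ?thesis
      unfolding that by (simp add: distrib_left mult.left_commute)
  qed
  ultimately show ?thesis
    unfolding 1 2 3 G_def[symmetric] power_Suc h_def[symmetric] by blast
qed

text \<open>Both coefficients with k = 0 are 1, so the difference of the two polynomials has no
  constant term and W can be split off. Hence the index \<open>Suc k\<close> on the right against k
  on the left.\<close>

lemma jcoef_lower:
  assumes "0 < p" "p < 1" "0 < x" "x < 1" "0 < u" "u \<le> 1" "0 < v" "v \<le> 1"
  shows "jcoef p (x * p) u v k =
     u * (1 - x) / (1 - x * u * v * p) * (jcoef p x u v (Suc k) - jcoef p x (u * p) (v * p) (Suc k))"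
proof -
  define h where "h = p ^ k"
  define G where "G = jcoef p x u v k"
  have ne: "x \<noteq> 1" "x * v \<noteq> 1" "x * u * v * p \<noteq> 1" "x * h \<noteq> 1" "u \<noteq> 0" "p * h \<noteq> 1" "h \<noteq> 0" "p \<noteq> 0"
    using assms mult_power_less_one[of p x k] mult_less_one[of x u] mult_less_one[of x v]
      mult_less_one[of "x * u" v] mult_less_one[of "x * u * v" p] mult_power_less_one[of p p k]
    by (auto simp: h_def)
  have 1: "jcoef p x u v (Suc k) = G * ((1 - h / u) * (1 - x * v * h) * p / ((1 - x * h) * (1 - p * h)))"
    unfolding G_def h_def by (rule jcoef_Suc)
  have "jcoef p x u (v * p) k = G * ((1 - x * v * h) / (1 - x * v))"
    unfolding G_def h_def using ne by (intro jcoef_shift_v) auto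
  then have 2: "jcoef p x (u * p) (v * p) (Suc k) =
      G * (((1 - x * v * h) / (1 - x * v)) * ((1 - 1 / (u * p)) * (1 - x * v * p * h) * p / ((1 - x * h) * (1 - p * h))))"
    using jcoef_Suc_shift_u[OF ne(8), of x u "v * p" k] unfolding h_def by (simp add: mult.assoc)
  have 3: "jcoef p (x * p) u v k = G * ((1 - x * v * h) * (1 - x) / ((1 - x * v) * (1 - x * h)))"
    unfolding G_def h_def using ne by (intro jcoef_shift_x) auto
  have "(1 - x * v * h) * (1 - x) / ((1 - x * v) * (1 - x * h)) =
    u * (1 - x) / (1 - x * u * v * p) * ((1 - h / u) * (1 - x * v * h) * p / ((1 - x * h) * (1 - p * h))
    - ((1 - x * v * h) / (1 - x * v)) * ((1 - 1 / (u * p)) * (1 - x * v * p * h) * p / ((1 - x * h) * (1 - p * h))))"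
    using ne by (simp add: divide_simps) algebra
  moreover have "\<And>t c A B :: real. t = c * (A - B) \<Longrightarrow> G * t = c * (G * A - G * B)"
    by algebra
  ultimately show ?thesis
    unfolding 1 2 3 G_def[symmetric] by blast
qed

section \<open>The polynomial part\<close>

text \<open>The little q-Jacobi polynomial P_n^(beta, N - n), made homogeneous in C and W so that C
  need not be invertible. It is what remains of a disk polynomial once the power of A or B is split
  off.\<close>

definition dpoly :: "real \<Rightarrow> nat \<Rightarrow> nat \<Rightarrow> real \<Rightarrow> 'a::real_algebra_1 \<Rightarrow> 'a \<Rightarrow> 'a" where
  "dpoly \<beta> n N p C W = (\<Sum>k\<le>n. Rcoef \<beta> n N p k *\<^sub>R (C ^ (n - k) * W ^ k))"

lemma powr_in_unit_interval:
  fixes p :: real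
  assumes "0 < p" "p < 1" "a > 0"
  shows "0 < p powr a" "p powr a < 1"
  using assms powr_less_mono'[of p 0 a] by auto

lemma powr_add_one: "0 < p \<Longrightarrow> p powr (a + 1) = p powr a * p" for p :: real
  by (simp add: powr_add)

lemma power_commute_left:
  fixes a b :: "'a::monoid_mult"
  assumes "a * b = b * a"
  shows "a * b ^ n = b ^ n * a"
  by (metis assms power_commuting_commutes)

lemma Rdisk_ge:
  assumes "m \<le> l" "C * A = A * C"
  shows "Rdisk \<beta> l m A B C p = A ^ (l - m) * dpoly \<beta> m l p C (C - A * B)"
proof -
  have "C ^ i * A ^ j = A ^ j * C ^ i" for i j
    using assms(2) by (metis power_commuting_commutes)
  then have "of_real r * C ^ i * A ^ j * W = A ^ j * (r *\<^sub>R (C ^ i * W))" for i j r W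
    by (simp only: scaleR_conv_of_real[symmetric] mult_scaleR_left mult_scaleR_right mult.assoc[symmetric])
  then show ?thesis
    using assms(1) unfolding Rdisk_def dpoly_def
    by (simp only: atLeast0AtMost sum_distrib_left if_True)
qed

lemma Rdisk_le:
  assumes "l \<le> m"
  shows "Rdisk \<beta> l m A B C p = dpoly \<beta> l m p C (C - A * B) * B ^ (m - l)"
  using assms unfolding Rdisk_def dpoly_def
  by (cases "l = m") (simp_all add: atLeast0AtMost sum_distrib_right flip: scaleR_conv_of_real)

lemma Rcoef_0 [simp]: "Rcoef \<beta> n N p 0 = 1"
  by (simp add: Rcoef_def)

lemma dpoly_0 [simp]: "dpoly \<beta> 0 N p C W = 1"
  by (simp add: dpoly_def)

text \<open>The added term k = n + 1 has coefficient zero because the series terminates. With it,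
  all polynomials in a contiguous relation are sums over the same range.\<close>

lemma mult_dpoly:
  assumes "0 < p"
  shows "C * dpoly \<beta> n N p C W = (\<Sum>k\<le>Suc n. Rcoef \<beta> n N p k *\<^sub>R (C ^ (Suc n - k) * W ^ k))"
proof -
  have "C * dpoly \<beta> n N p C W = (\<Sum>k\<le>n. Rcoef \<beta> n N p k *\<^sub>R (C ^ (Suc n - k) * W ^ k))"
    unfolding dpoly_def sum_distrib_left
    by (intro sum.cong) (auto simp: Suc_diff_le mult.assoc)
  then show ?thesis
    using assms by (simp add: Rcoef_eq_jcoef jcoef_eq_0)
qed

lemma dpoly_raise:
  assumes "0 < p" "p < 1" "\<beta> > -1" "n \<le> N"
  defines "x \<equiv> p powr (\<beta> + 1)"
  shows "dpoly \<beta> n N p C W =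
     ((1 - x * p ^ n) * (1 - x * p ^ N) / ((1 - x * p ^ n * p ^ N) * (1 - x))) *\<^sub>R dpoly (\<beta> + 1) n N p C W
     - (x * (1 - p ^ n) * (1 - p ^ N) / ((1 - x * p ^ n * p ^ N) * (1 - x))) *\<^sub>R
         (C * dpoly (\<beta> + 1) (n - 1) (N - 1) p C W)"
proof (cases n)
  \<comment> \<open>Degree 0 is outside \<open>jcoef_raise\<close>. Here the second scalar contains
    1 - p ^ 0 = 0, so the truncated n - 1 does no harm.\<close>
  case 0
  have x: "0 < x" "x < 1" "x * p ^ N < 1"
    using powr_in_unit_interval[of p "\<beta> + 1"] mult_power_less_one[of p x N] assms(1-3) by (auto simp: x_def)
  then show ?thesis using 0 by (simp add: mult.commute)
next
  case (Suc n')
  then obtain N' where N: "N = Suc N'"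
    using assms(4) by (cases N) auto
  have x: "0 < x" "x < 1" "p powr (\<beta> + 1 + 1) = x * p"
    using powr_in_unit_interval[of p "\<beta> + 1"] powr_add_one[of p "\<beta> + 1"] assms(1-3) by (auto simp: x_def)
  have pw: "0 < p ^ n" "p ^ n < 1" "0 < p ^ N" "p ^ N < 1" "p ^ n' = p ^ n / p" "p ^ (N - 1) = p ^ N / p"
    using assms(1,2) power_Suc_less_one[of p] by (simp_all add: Suc N)
  have "C * dpoly (\<beta> + 1) (n - 1) (N - 1) p C W =
     (\<Sum>k\<le>n. Rcoef (\<beta> + 1) n' (N - 1) p k *\<^sub>R (C ^ (n - k) * W ^ k))"
    using mult_dpoly[OF assms(1), of C "\<beta> + 1" n' "N - 1" W] Suc by simp
  moreover have "Rcoef \<beta> n N p k =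
      (1 - x * p ^ n) * (1 - x * p ^ N) / ((1 - x * p ^ n * p ^ N) * (1 - x)) * Rcoef (\<beta> + 1) n N p k
      - x * (1 - p ^ n) * (1 - p ^ N) / ((1 - x * p ^ n * p ^ N) * (1 - x)) * Rcoef (\<beta> + 1) n' (N - 1) p k" for k
    using jcoef_raise[OF assms(1,2) x(1,2) pw(1-4), of k] assms(1)
    by (simp only: Rcoef_eq_jcoef x pw(5,6) x_def[symmetric])
  ultimately show ?thesis
    unfolding dpoly_def
    by (simp only: scaleR_sum_right sum_subtractf[symmetric] scaleR_scaleR scaleR_diff_left[symmetric])
qed

lemma dpoly_left_ge:
  assumes "0 < p" "p < 1" "\<beta> > -1"
  defines "x \<equiv> p powr (\<beta> + 1)"
  shows "dpoly \<beta> n N p C W =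
     ((1 - x * p ^ N) / (1 - x * p ^ n * p ^ N)) *\<^sub>R dpoly \<beta> n (Suc N) p C W
     + (x * p ^ N * (1 - p ^ n) / (1 - x * p ^ n * p ^ N)) *\<^sub>R (C * dpoly \<beta> (n - 1) N p C W)"
proof (cases n)
  case 0
  have x: "0 < x" "x < 1" "x * p ^ N < 1"
    using powr_in_unit_interval[of p "\<beta> + 1"] mult_power_less_one[of p x N] assms(1-3) by (auto simp: x_def)
  then show ?thesis using 0 by auto
next
  case (Suc n')
  have x: "0 < x" "x < 1"
    using powr_in_unit_interval[of p "\<beta> + 1"] powr_add_one[of p "\<beta> + 1"] assms(1-3) by (auto simp: x_def)
  have pw: "0 < p ^ n" "p ^ n < 1" "0 < p ^ N" "p ^ N \<le> 1" "p ^ n' = p ^ n / p" "p ^ Suc N = p ^ N * p"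
    using assms Suc power_Suc_less_one[of p n'] by (auto simp: power_le_one)
  have "C * dpoly \<beta> (n - 1) N p C W =
     (\<Sum>k\<le>n. Rcoef \<beta> n' N p k *\<^sub>R (C ^ (n - k) * W ^ k))"
    using mult_dpoly[OF assms(1), of C \<beta> n' N W] Suc by simp
  moreover have "Rcoef \<beta> n N p k =
      (1 - x * p ^ N) / (1 - x * p ^ n * p ^ N) * Rcoef \<beta> n (Suc N) p k
      + x * p ^ N * (1 - p ^ n) / (1 - x * p ^ n * p ^ N) * Rcoef \<beta> n' N p k" for k
    using jcoef_left_ge[OF assms(1,2) x pw(1-4), of k] assms(1)
    by (simp only: Rcoef_eq_jcoef pw(5,6) x_def[symmetric])
  ultimately show ?thesis
    unfolding dpoly_def
    by (simp only: scaleR_sum_right sum.distrib[symmetric] scaleR_scaleR scaleR_add_left[symmetric])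
qed

lemma dpoly_lower:
  assumes "0 < p" "p < 1" "\<beta> > -1"
  defines "x \<equiv> p powr (\<beta> + 1)"
  shows "dpoly (\<beta> + 1) n N p C W * W =
     (p ^ n * (1 - x) / (1 - x * p ^ n * p ^ N * p)) *\<^sub>R
       (C * dpoly \<beta> n N p C W - dpoly \<beta> (Suc n) (Suc N) p C W)"
proof -
  have x: "0 < x" "x < 1" "p powr (\<beta> + 1 + 1) = x * p"
    using powr_in_unit_interval[of p "\<beta> + 1"] powr_add_one[of p "\<beta> + 1"] assms(1-3) by (auto simp: x_def)
  have pw: "0 < p ^ n" "p ^ n \<le> 1" "0 < p ^ N" "p ^ N \<le> 1" "p ^ Suc n = p ^ n * p" "p ^ Suc N = p ^ N * p"
    using assms by (auto simp: power_le_one)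
  have "C * dpoly \<beta> n N p C W - dpoly \<beta> (Suc n) (Suc N) p C W =
     (\<Sum>k\<le>Suc n. (Rcoef \<beta> n N p k - Rcoef \<beta> (Suc n) (Suc N) p k) *\<^sub>R (C ^ (Suc n - k) * W ^ k))"
    unfolding mult_dpoly[OF assms(1)] unfolding dpoly_def
    by (simp only: sum_subtractf[symmetric] scaleR_diff_left[symmetric])
  also have "\<dots> = (\<Sum>k\<le>n. (Rcoef \<beta> n N p (Suc k) - Rcoef \<beta> (Suc n) (Suc N) p (Suc k)) *\<^sub>R (C ^ (n - k) * W ^ Suc k))"
    by (subst sum.atMost_Suc_shift) simp
  finally have 1: "C * dpoly \<beta> n N p C W - dpoly \<beta> (Suc n) (Suc N) p C W = \<dots>" .
  have 2: "Rcoef (\<beta> + 1) n N p k = p ^ n * (1 - x) / (1 - x * p ^ n * p ^ N * p) *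
      (Rcoef \<beta> n N p (Suc k) - Rcoef \<beta> (Suc n) (Suc N) p (Suc k))" for k
    using jcoef_lower[OF assms(1,2) x(1,2) pw(1-4), of k] assms(1)
    by (simp only: Rcoef_eq_jcoef pw(5,6) x x_def[symmetric])
  show ?thesis
    unfolding 1 unfolding dpoly_def sum_distrib_right scaleR_sum_right 2
    by (simp only: mult_scaleR_left scaleR_scaleR mult.assoc power_Suc2)
qed

lemma dpoly_left_le:
  fixes A B C W :: "'a::real_algebra_1"
  assumes "0 < p" "p < 1" "\<beta> > -1" "n < N"
    and CA: "C * A = A * C" and CW: "C * W = W * C" and WA: "W * A = p *\<^sub>R (A * W)"
    and W: "W = C - A * B"
  defines "x \<equiv> p powr (\<beta> + 1)"
  shows "A * dpoly \<beta> n N p C W * B =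
     ((1 - x * p ^ n) / (1 - x * p ^ n * p ^ N)) *\<^sub>R dpoly \<beta> (Suc n) N p C W
     + (x * p ^ n * (1 - p ^ N) / (1 - x * p ^ n * p ^ N)) *\<^sub>R (C * dpoly \<beta> n (N - 1) p C W)"
proof -
  have x: "0 < x" "x < 1"
    using powr_in_unit_interval[of p "\<beta> + 1"] powr_add_one[of p "\<beta> + 1"] assms(1-3) by (auto simp: x_def)
  have pw: "0 < p ^ n" "p ^ n \<le> 1" "0 < p ^ N" "p ^ N \<le> 1" "p ^ Suc n = p ^ n * p" "p ^ (N - 1) = p ^ N / p"
    using assms by (auto simp: power_le_one power_diff)
  have ne: "x * p ^ n * p ^ N \<noteq> 1"
    using mult_less_one[of "x * p ^ n" "p ^ N"] mult_less_one[of x "p ^ n"] x pw by auto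
  define c where "c = (1 - x * p ^ n) / (1 - x * p ^ n * p ^ N)"
  define d where "d = x * p ^ n * (1 - p ^ N) / (1 - x * p ^ n * p ^ N)"
  \<comment> \<open>This is the coefficient of C^(n+1), where both polynomials on the right have
    leading coefficient 1.\<close>
  have cd: "c + d = 1"
    using ne by (simp add: c_def d_def divide_simps) algebra
  let ?g = "\<lambda>k. Rcoef \<beta> n N p k / p ^ k"
  let ?E = "\<lambda>k. C ^ (Suc n - k) * W ^ k"
  have AWk: "A * W ^ k = (1 / p ^ k) *\<^sub>R (W ^ k * A)" for k
  proof (induction k)
    case (Suc k)
    have "A * W ^ Suc k = (1 / p ^ k) *\<^sub>R (W ^ k * (A * W))"
      using Suc by (simp add: power_Suc2 mult.assoc[symmetric] del: power_Suc)
    also have "A * W = (1 / p) *\<^sub>R (W * A)"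
      using WA assms(1) by simp
    finally show ?case
      by (simp add: power_Suc2 mult.assoc[symmetric] mult.commute del: power_Suc)
  qed simp
  have summand: "A * (Rcoef \<beta> n N p k *\<^sub>R (C ^ (n - k) * W ^ k)) * B = ?g k *\<^sub>R ?E k - ?g k *\<^sub>R ?E (Suc k)"
    if "k \<le> n" for k
  proof -
    have "A * (C ^ (n - k) * W ^ k) * B = C ^ (n - k) * (A * W ^ k) * B"
      using power_commute_left[OF CA[symmetric], of "n - k"] by (simp add: mult.assoc[symmetric])
    also have "\<dots> = (1 / p ^ k) *\<^sub>R (C ^ (n - k) * W ^ k * (A * B))"
      by (simp add: AWk mult.assoc)
    also have "A * B = C - W"
      using W by simp
    also have "C ^ (n - k) * W ^ k * (C - W) = ?E k - ?E (Suc k)"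
    proof -
      have "C ^ (n - k) * W ^ k * C = C ^ (n - k) * C * W ^ k"
        using power_commute_left[OF CW, of k] by (simp add: mult.assoc)
      also have "\<dots> = ?E k"
        using that by (simp add: Suc_diff_le power_commutes)
      finally show ?thesis
        by (simp add: right_diff_distrib mult.assoc power_Suc2 del: power_Suc)
    qed
    finally show ?thesis
      by (simp add: scaleR_diff_right)
  qed
  have "A * dpoly \<beta> n N p C W * B = (\<Sum>k\<le>n. ?g k *\<^sub>R ?E k) - (\<Sum>k\<le>n. ?g k *\<^sub>R ?E (Suc k))"
    unfolding dpoly_def sum_distrib_left sum_distrib_right
    by (subst sum_subtractf[symmetric], rule sum.cong) (auto simp only: summand atMost_iff)
  also have "(\<Sum>k\<le>n. ?g k *\<^sub>R ?E k) = (\<Sum>k\<le>Suc n. ?g k *\<^sub>R ?E k)"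
    using assms(1) by (simp add: Rcoef_eq_jcoef jcoef_eq_0)
  also have "\<dots> = ?E 0 + (\<Sum>k\<le>n. ?g (Suc k) *\<^sub>R ?E (Suc k))"
    by (subst sum.atMost_Suc_shift) simp
  finally have L: "A * dpoly \<beta> n N p C W * B = ?E 0 + (\<Sum>k\<le>n. (?g (Suc k) - ?g k) *\<^sub>R ?E (Suc k))"
    by (simp only: sum_subtractf scaleR_diff_left add_diff_eq)
  let ?h = "\<lambda>k. c * Rcoef \<beta> (Suc n) N p k + d * Rcoef \<beta> n (N - 1) p k"
  have hg: "?h (Suc k) = ?g (Suc k) - ?g k" for k
    using jcoef_left_le[OF assms(1,2) x pw(1-4), of k] assms(1)
    unfolding c_def d_def by (simp only: Rcoef_eq_jcoef pw(5,6) x_def[symmetric])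
  have "c *\<^sub>R dpoly \<beta> (Suc n) N p C W + d *\<^sub>R (C * dpoly \<beta> n (N - 1) p C W) = (\<Sum>k\<le>Suc n. ?h k *\<^sub>R ?E k)"
    unfolding mult_dpoly[OF assms(1)] unfolding dpoly_def
    by (simp only: scaleR_sum_right sum.distrib[symmetric] scaleR_scaleR scaleR_add_left[symmetric])
  also have "\<dots> = ?E 0 + (\<Sum>k\<le>n. ?h (Suc k) *\<^sub>R ?E (Suc k))"
    using cd by (subst sum.atMost_Suc_shift) simp
  also have "\<dots> = A * dpoly \<beta> n N p C W * B"
    unfolding L hg ..
  finally show ?thesis
    unfolding c_def d_def by (rule sym)
qed

section \<open>Recurrences of the disk polynomials\<close>

text \<open>
  The only relations that the recurrences of the disk polynomials need. They hold for
  $(X_2,X_2^*,Q)$, $(X_1,X_1^*,Q-X_2X_2^*)$, $(Y_2,Y_2^*,D)$ and also for the three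
  arguments on the left-hand side of the addition formula.
\<close>

definition qdisk :: "real \<Rightarrow> 'a::real_algebra_1 \<Rightarrow> 'a \<Rightarrow> 'a \<Rightarrow> bool" where
  "qdisk p A B C \<longleftrightarrow>
     C * A = A * C \<and> C * B = B * C \<and> B * A = p *\<^sub>R (A * B) + (1 - p) *\<^sub>R C"

text \<open>The relation for \<open>B * A\<close> is equivalent to C - B A = p (C - A B), and (C - A
  B) A = A (C - B A) since C is central here; so the defect C - A B skew-commutes with A and
  B.\<close>

lemma qdisk_defect:
  assumes "qdisk p A B C"
  shows "C * (C - A * B) = (C - A * B) * C"
    and "(C - A * B) * A = p *\<^sub>R (A * (C - A * B))"
    and "B * (C - A * B) = p *\<^sub>R ((C - A * B) * B)"
proof -
  have CA: "C * A = A * C" and CB: "C * B = B * C"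
    and BA: "B * A = p *\<^sub>R (A * B) + (1 - p) *\<^sub>R C"
    using assms by (auto simp: qdisk_def)
  have "C * (A * B) = A * B * C"
    by (metis CA CB mult.assoc)
  then show "C * (C - A * B) = (C - A * B) * C"
    by (simp add: algebra_simps)
  have D: "C - B * A = p *\<^sub>R (C - A * B)"
    unfolding BA by (simp add: algebra_simps)
  have "(C - A * B) * A = A * (C - B * A)"
    by (simp add: algebra_simps CA)
  then show "(C - A * B) * A = p *\<^sub>R (A * (C - A * B))"
    unfolding D by simp
  have "B * (C - A * B) = (C - B * A) * B"
    by (simp add: algebra_simps CB)
  then show "B * (C - A * B) = p *\<^sub>R ((C - A * B) * B)"
    unfolding D by simp
qed

lemma Rdisk_0_0 [simp]: "Rdisk \<beta> 0 0 A B C p = 1"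
  by (simp add: Rdisk_def)

text \<open>The two shapes of \<open>Rdisk\<close> need different contiguous relations, but these
  yield the same scalars because u and v exchange their roles. The recurrence is thus uniform in j
  and k, as the double sum requires; for k = 0 the factor 1 - p ^ k removes the term with the
  truncated index.\<close>

lemma Rdisk_left:
  assumes p: "0 < p" "p < 1" and \<beta>: "\<beta> > -1" and qd: "qdisk p A B C"
  defines "x \<equiv> p powr (\<beta> + 1)"
  shows "A * Rdisk \<beta> j k A B C p =
     ((1 - x * p ^ j) / (1 - x * p ^ j * p ^ k)) *\<^sub>R Rdisk \<beta> (Suc j) k A B C p
     + (x * p ^ j * (1 - p ^ k) / (1 - x * p ^ j * p ^ k)) *\<^sub>R (C * Rdisk \<beta> j (k - 1) A B C p)"
proof -
  have CA: "C * A = A * C"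
    using qd by (simp add: qdisk_def)
  have CAi: "C * A ^ i = A ^ i * C" for i
    using CA by (rule power_commute_left)
  have xne: "x \<noteq> 1" "x * p ^ i \<noteq> 1" for i
    using powr_in_unit_interval[of p "\<beta> + 1"] mult_power_less_one[of p x i] p \<beta> by (auto simp: x_def)
  show ?thesis
  proof (cases "k \<le> j")
    case True
    have "A * Rdisk \<beta> j k A B C p = A ^ (Suc j - k) * dpoly \<beta> k j p C (C - A * B)"
      using True by (simp add: Rdisk_ge[OF True CA] Suc_diff_le mult.assoc)
    moreover have "Rdisk \<beta> (Suc j) k A B C p = A ^ (Suc j - k) * dpoly \<beta> k (Suc j) p C (C - A * B)"
      using True by (intro Rdisk_ge CA) auto
    moreover have "C * Rdisk \<beta> j (k - 1) A B C p =
        A ^ (Suc j - k) * (C * dpoly \<beta> (k - 1) j p C (C - A * B))" if "k > 0"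
    proof -
      have "k - 1 \<le> j" "j - (k - 1) = Suc j - k"
        using True that by auto
      then show ?thesis
        using Rdisk_ge[OF \<open>k - 1 \<le> j\<close> CA, of \<beta> B p] CAi[of "Suc j - k"] by (simp add: mult.assoc[symmetric])
    qed
    moreover have "x * p ^ k * p ^ j = x * p ^ j * p ^ k"
      by simp
    ultimately show ?thesis
      using dpoly_left_ge[OF p \<beta>, of k j C "C - A * B", folded x_def]
      using xne by (cases "k = 0") (simp_all add: distrib_left mult.assoc mult.commute[of "p ^ k" "p ^ j"])
  next
    case False
    then have jk: "j < k" by simp
    then have B: "B ^ (k - j) = B * B ^ (k - Suc j)"
      by (simp flip: power_Suc add: Suc_diff_Suc)
    have "A * Rdisk \<beta> j k A B C p = (A * dpoly \<beta> j k p C (C - A * B) * B) * B ^ (k - Suc j)"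
      using jk by (simp add: Rdisk_le B mult.assoc)
    moreover have "Rdisk \<beta> (Suc j) k A B C p = dpoly \<beta> (Suc j) k p C (C - A * B) * B ^ (k - Suc j)"
      using jk by (intro Rdisk_le) auto
    moreover have "Rdisk \<beta> j (k - 1) A B C p = dpoly \<beta> j (k - 1) p C (C - A * B) * B ^ (k - Suc j)"
      using jk by (subst Rdisk_le) auto
    ultimately show ?thesis
      unfolding dpoly_left_le[OF p \<beta> jk CA qdisk_defect(1,2)[OF qd] refl, folded x_def]
      by (simp add: distrib_right mult.assoc)
  qed
qed

lemma Rdisk_raise:
  assumes p: "0 < p" "p < 1" and \<beta>: "\<beta> > -1" and qd: "qdisk p A B C"
  defines "x \<equiv> p powr (\<beta> + 1)"
  shows "Rdisk \<beta> j k A B C p =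
     ((1 - x * p ^ j) * (1 - x * p ^ k) / ((1 - x * p ^ j * p ^ k) * (1 - x))) *\<^sub>R Rdisk (\<beta> + 1) j k A B C p
     - (x * (1 - p ^ j) * (1 - p ^ k) / ((1 - x * p ^ j * p ^ k) * (1 - x))) *\<^sub>R
         (C * Rdisk (\<beta> + 1) (j - 1) (k - 1) A B C p)"
proof -
  have CA: "C * A = A * C"
    using qd by (simp add: qdisk_def)
  have CAi: "C * A ^ i = A ^ i * C" for i
    using CA by (rule power_commute_left)
  have xne: "x \<noteq> 1" "x * p ^ i \<noteq> 1" for i
    using powr_in_unit_interval[of p "\<beta> + 1"] mult_power_less_one[of p x i] p \<beta> by (auto simp: x_def)
  show ?thesis
  proof (cases "k \<le> j")
    case True
    have R: "Rdisk \<gamma> j k A B C p = A ^ (j - k) * dpoly \<gamma> k j p C (C - A * B)" for \<gamma>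
      using Rdisk_ge[OF True CA] .
    have R': "C * Rdisk (\<beta> + 1) (j - 1) (k - 1) A B C p =
        A ^ (j - k) * (C * dpoly (\<beta> + 1) (k - 1) (j - 1) p C (C - A * B))" if "k > 0"
    proof -
      have "k - 1 \<le> j - 1" "j - 1 - (k - 1) = j - k"
        using True that by auto
      then show ?thesis
        using Rdisk_ge[OF \<open>k - 1 \<le> j - 1\<close> CA, of "\<beta> + 1" B p] CAi[of "j - k"]
        by (simp add: mult.assoc[symmetric])
    qed
    have ac: "x * p ^ k * p ^ j = x * p ^ j * p ^ k" "(1 - x * p ^ k) * (1 - x * p ^ j) = (1 - x * p ^ j) * (1 - x * p ^ k)"
       "x * (1 - p ^ k) * (1 - p ^ j) = x * (1 - p ^ j) * (1 - p ^ k)"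
      by simp_all
    show ?thesis
    proof (cases "k = 0")
      case True
      then show ?thesis
        using xne R[of \<beta>] R[of "\<beta> + 1"] by simp
    next
      case False
      then show ?thesis
        using dpoly_raise[OF p \<beta> \<open>k \<le> j\<close>, of C "C - A * B", folded x_def, unfolded ac]
        by (simp only: R R' mult_scaleR_right[symmetric] right_diff_distrib[symmetric] neq0_conv)
    qed
  next
    case False
    then have jk: "j \<le> k" by simp
    have R: "Rdisk \<gamma> j k A B C p = dpoly \<gamma> j k p C (C - A * B) * B ^ (k - j)" for \<gamma>
      using Rdisk_le[OF jk] .
    have R': "C * Rdisk (\<beta> + 1) (j - 1) (k - 1) A B C p =
        C * dpoly (\<beta> + 1) (j - 1) (k - 1) p C (C - A * B) * B ^ (k - j)" if "j > 0"
    proof -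
      have "j - 1 \<le> k - 1" "k - 1 - (j - 1) = k - j"
        using jk that by auto
      then show ?thesis
        using Rdisk_le[OF \<open>j - 1 \<le> k - 1\<close>, of "\<beta> + 1" A B C p]
        by (simp add: mult.assoc)
    qed
    show ?thesis
    proof (cases "j = 0")
      case True
      then show ?thesis
        using xne R[of \<beta>] R[of "\<beta> + 1"] by simp
    next
      case False
      then show ?thesis
        using dpoly_raise[OF p \<beta> jk, of C "C - A * B", folded x_def]
        by (simp only: R R' mult_scaleR_left[symmetric] left_diff_distrib[symmetric] neq0_conv)
    qed
  qed
qed

lemma power_skew_commute:
  fixes B W :: "'a::real_algebra_1"
  assumes "B * W = p *\<^sub>R (W * B)"
  shows "B ^ n * W = p ^ n *\<^sub>R (W * B ^ n)"
proof (induction n)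
  case (Suc n)
  have "B ^ Suc n * W = B * (B ^ n * W)"
    by (simp add: mult.assoc)
  also have "\<dots> = p ^ n *\<^sub>R (B * W * B ^ n)"
    using Suc by (simp add: mult.assoc)
  finally show ?case
    using assms by (simp add: mult.assoc mult.commute)
qed simp

lemma Rdisk_lower:
  assumes p: "0 < p" "p < 1" and \<beta>: "\<beta> > -1" and qd: "qdisk p A B C"
  defines "x \<equiv> p powr (\<beta> + 1)"
  shows "Rdisk (\<beta> + 1) j k A B C p * (C - A * B) =
     (p ^ k * (1 - x) / (1 - x * p ^ j * p ^ k * p)) *\<^sub>R
       (C * Rdisk \<beta> j k A B C p - Rdisk \<beta> (Suc j) (Suc k) A B C p)"
proof -
  have CA: "C * A = A * C"
    using qd by (simp add: qdisk_def)
  have CAi: "C * A ^ i = A ^ i * C" for i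
    using CA by (rule power_commute_left)
  let ?W = "C - A * B"
  show ?thesis
  proof (cases "k \<le> j")
    case True
    have "Rdisk (\<beta> + 1) j k A B C p * ?W = A ^ (j - k) * (dpoly (\<beta> + 1) k j p C ?W * ?W)"
      using Rdisk_ge[OF True CA] by (simp add: mult.assoc)
    also have "\<dots> = (p ^ k * (1 - x) / (1 - x * p ^ k * p ^ j * p)) *\<^sub>R
       (A ^ (j - k) * (C * dpoly \<beta> k j p C ?W - dpoly \<beta> (Suc k) (Suc j) p C ?W))"
      using dpoly_lower[OF p \<beta>, of k j C ?W, folded x_def] by simp
    also have "A ^ (j - k) * (C * dpoly \<beta> k j p C ?W - dpoly \<beta> (Suc k) (Suc j) p C ?W) =
       C * Rdisk \<beta> j k A B C p - Rdisk \<beta> (Suc j) (Suc k) A B C p"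
      using Rdisk_ge[OF True CA, of \<beta> B p] Rdisk_ge[of "Suc k" "Suc j" C A \<beta> B p, OF _ CA] True CAi[of "j - k"]
      by (simp add: right_diff_distrib mult.assoc[symmetric])
    also have "x * p ^ k * p ^ j = x * p ^ j * p ^ k"
      by simp
    finally show ?thesis .
  next
    case False
    then have jk: "j \<le> k" by simp
    have "Rdisk (\<beta> + 1) j k A B C p * ?W = dpoly (\<beta> + 1) j k p C ?W * (B ^ (k - j) * ?W)"
      using Rdisk_le[OF jk, of "\<beta> + 1" A B C p] by (simp add: mult.assoc)
    \<comment> \<open>Moving the defect to the left through B^(k-j) costs p^(k-j). This turns the
      p^j of \<open>dpoly_lower\<close> into p^k, the scalar of the other case.\<close>
    also have "\<dots> = p ^ (k - j) *\<^sub>R (dpoly (\<beta> + 1) j k p C ?W * ?W * B ^ (k - j))"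
      unfolding power_skew_commute[OF qdisk_defect(3)[OF qd]] by (simp only: mult_scaleR_right mult.assoc)
    also have "\<dots> = (p ^ (k - j) * (p ^ j * (1 - x) / (1 - x * p ^ j * p ^ k * p))) *\<^sub>R
       ((C * dpoly \<beta> j k p C ?W - dpoly \<beta> (Suc j) (Suc k) p C ?W) * B ^ (k - j))"
      using dpoly_lower[OF p \<beta>, of j k C ?W, folded x_def] by simp
    also have "(C * dpoly \<beta> j k p C ?W - dpoly \<beta> (Suc j) (Suc k) p C ?W) * B ^ (k - j) =
       C * Rdisk \<beta> j k A B C p - Rdisk \<beta> (Suc j) (Suc k) A B C p"
      using Rdisk_le[OF jk, of \<beta> A B C p] Rdisk_le[of "Suc j" "Suc k" \<beta> A B C p] jk
      by (simp add: left_diff_distrib mult.assoc)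
    also have "p ^ (k - j) * (p ^ j * (1 - x) / (1 - x * p ^ j * p ^ k * p)) =
        p ^ k * (1 - x) / (1 - x * p ^ j * p ^ k * p)"
      using jk by (simp add: mult.assoc[symmetric] power_add[symmetric])
    finally show ?thesis .
  qed
qed

section \<open>Skew commutation with disk polynomials\<close>

lemma dpoly_commute:
  fixes C W Z :: "'a::real_algebra_1"
  assumes "Z * C = C * Z" "Z * W = W * Z"
  shows "Z * dpoly \<beta> n N p C W = dpoly \<beta> n N p C W * Z"
proof -
  have "Z * (C ^ i * W ^ k) = C ^ i * W ^ k * Z" for i k
    using power_commute_left[OF assms(1), of i] power_commute_left[OF assms(2), of k]
    by (metis mult.assoc)
  then show ?thesis
    by (simp add: dpoly_def sum_distrib_left sum_distrib_right)
qed

text \<open>Z picks up t from A and 1/t from B, so it commutes with A B and with the polynomial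
  part; only the outer power of A or B contributes, which gives t^(j-k) in all. Powers of t on both
  sides avoid a negative exponent.\<close>

lemma Rdisk_skew_commute:
  fixes A B C Z :: "'a::real_algebra_1"
  assumes CA: "C * A = A * C" and ZC: "Z * C = C * Z"
    and ZA: "Z * A = t *\<^sub>R (A * Z)" and BZ: "B * Z = t *\<^sub>R (Z * B)"
  shows "t ^ k *\<^sub>R (Z * Rdisk \<beta> j k A B C p) = t ^ j *\<^sub>R (Rdisk \<beta> j k A B C p * Z)"
proof -
  have "Z * (A * B) = t *\<^sub>R (A * Z) * B"
    using ZA by (simp add: mult.assoc[symmetric])
  also have "\<dots> = A * B * Z"
    using BZ by (simp add: mult.assoc)
  finally have "Z * (C - A * B) = (C - A * B) * Z"
    using ZC by (simp add: algebra_simps)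
  note D = dpoly_commute[OF ZC this, of \<beta> _ _ p]
  show ?thesis
  proof (cases "k \<le> j")
    case True
    have "Z * A ^ n = t ^ n *\<^sub>R (A ^ n * Z)" for n
    proof (induction n)
      case (Suc n)
      have "Z * A ^ Suc n = t *\<^sub>R (A * (Z * A ^ n))"
        using ZA by (simp add: mult.assoc[symmetric])
      then show ?case
        using Suc by (simp add: mult.assoc)
    qed simp
    then have "Z * Rdisk \<beta> j k A B C p = t ^ (j - k) *\<^sub>R (Rdisk \<beta> j k A B C p * Z)"
      unfolding Rdisk_ge[OF True CA] using D[of k j] by (simp add: mult.assoc[symmetric]) (simp add: mult.assoc)
    then show ?thesis
      using True by (simp add: power_add[symmetric])
  next
    case False
    then have jk: "j \<le> k" by simp
    have "Rdisk \<beta> j k A B C p * Z = t ^ (k - j) *\<^sub>R (dpoly \<beta> j k p C (C - A * B) * Z * B ^ (k - j))"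
      unfolding Rdisk_le[OF jk] using power_skew_commute[OF BZ, of "k - j"] by (simp add: mult.assoc)
    also have "\<dots> = t ^ (k - j) *\<^sub>R (Z * Rdisk \<beta> j k A B C p)"
      unfolding Rdisk_le[OF jk] D[of j k, symmetric] by (simp only: mult.assoc)
    finally show ?thesis
      using jk by (simp add: power_add[symmetric])
  qed
qed

lemma Rdisk_commute:
  fixes A B C Z :: "'a::real_algebra_1"
  assumes "C * A = A * C" "Z * A = A * Z" "Z * B = B * Z" "Z * C = C * Z"
  shows "Z * Rdisk \<beta> j k A B C p = Rdisk \<beta> j k A B C p * Z"
  using Rdisk_skew_commute[of C A Z 1 B k \<beta> j p] assms by simp

section \<open>The connection coefficients\<close>

text \<open>
  \<open>norm_coef\<close> and \<open>acoef\<close> are \<open>cc\<close> and \<open>cc4\<close> in terms of $p = q^2$, with $y = p^{\alpha+1}$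
  and $x = p^\alpha$.
\<close>

definition norm_coef :: "real \<Rightarrow> real \<Rightarrow> nat \<Rightarrow> nat \<Rightarrow> real" where
  "norm_coef p y l m = (1 - y) * y ^ m / (1 - y * p ^ l * p ^ m) * (qpoch p p l * qpoch p p m)
     / (qpoch y p l * qpoch y p m)"

definition acoef :: "real \<Rightarrow> real \<Rightarrow> nat \<Rightarrow> nat \<Rightarrow> nat \<Rightarrow> nat \<Rightarrow> real" where
  "acoef p x l m r s = (1 - x * p ^ r * p ^ s * p) / (1 - x * p) * norm_coef p (x * p) l m
     / (norm_coef p (x * p ^ r * p ^ s * p) (l - r) (m - s) * norm_coef p x r s)"

lemma cc_eq_norm_coef:
  assumes "0 < q"
  shows "cc q \<alpha> l m = norm_coef (q\<^sup>2) (q\<^sup>2 powr (\<alpha> + 1)) l m"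
proof -
  have P: "q powr (2 * a) = q\<^sup>2 powr a" for a
    using assms by (simp add: powr_powr flip: powr_numeral)
  have "2 * real m * (\<alpha> + 1) = 2 * ((\<alpha> + 1) * real m)"
    by simp
  then have "q powr (2 * real m * (\<alpha> + 1)) = q\<^sup>2 powr ((\<alpha> + 1) * real m)"
    using P by metis
  also have "\<dots> = (q\<^sup>2 powr (\<alpha> + 1)) ^ m"
    using assms by (simp only: powr_powr[symmetric]) (simp add: powr_realpow)
  finally have "q powr (2 * real m * (\<alpha> + 1)) = (q\<^sup>2 powr (\<alpha> + 1)) ^ m" .
  moreover have "q\<^sup>2 powr (\<alpha> + real l + real m + 1) = q\<^sup>2 powr (\<alpha> + 1) * (q\<^sup>2) ^ l * (q\<^sup>2) ^ m"
    using assms by (simp add: powr_add powr_realpow)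
  ultimately show ?thesis
    by (simp only: cc_def norm_coef_def P)
qed

lemma cc4_eq_acoef:
  assumes "0 < q"
  shows "cc4 q \<alpha> l m r s = acoef (q\<^sup>2) (q\<^sup>2 powr \<alpha>) l m r s"
proof -
  have P: "q powr (2 * a) = q\<^sup>2 powr a" for a
    using assms by (simp add: powr_powr flip: powr_numeral)
  have "q\<^sup>2 powr (\<alpha> + real r + real s + 1) = q\<^sup>2 powr \<alpha> * (q\<^sup>2) ^ r * (q\<^sup>2) ^ s * q\<^sup>2"
    "q\<^sup>2 powr (\<alpha> + 1) = q\<^sup>2 powr \<alpha> * q\<^sup>2"
    using assms by (simp_all add: powr_add powr_realpow)
  then show ?thesis
    unfolding cc4_def acoef_def cc_eq_norm_coef[OF assms] P by simp
qed

section \<open>Quotients of neighbouring connection coefficients\<close>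

lemma power_sub_one_neq_0:
  fixes p :: real
  assumes "0 < p" "p < 1"
  shows "1 - p ^ n * p \<noteq> 0"
  using mult_power_less_one[OF assms assms, of n] by (simp add: mult.commute)

lemma norm_coef_pos:
  assumes "0 < p" "p < 1" "0 < y" "y < 1"
  shows "0 < norm_coef p y l m"
proof -
  have "y * p ^ l * p ^ m < 1"
    using mult_power_less_one[OF assms, of "l + m"] by (simp add: power_add mult.assoc)
  then show ?thesis
    using assms by (simp add: norm_coef_def qpoch_pos)
qed

lemma norm_coef_Suc_left:
  assumes "0 < p" "p < 1" "0 < y" "y < 1"
  shows "norm_coef p y (Suc l) m = norm_coef p y l m *
    ((1 - y * p ^ l * p ^ m) * (1 - p ^ l * p) / ((1 - y * p ^ l * p ^ m * p) * (1 - y * p ^ l)))"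
proof -
  have "y * p ^ l * p ^ m \<noteq> 1"
    using mult_power_less_one[OF assms, of "l + m"] by (simp add: power_add mult.assoc)
  then show ?thesis
    by (simp add: norm_coef_def qpoch_Suc mult_ac)
qed

lemma norm_coef_Suc_right:
  assumes "0 < p" "p < 1" "0 < y" "y < 1"
  shows "norm_coef p y l (Suc m) = norm_coef p y l m *
    (y * (1 - y * p ^ l * p ^ m) * (1 - p ^ m * p) / ((1 - y * p ^ l * p ^ m * p) * (1 - y * p ^ m)))"
proof -
  have "y * p ^ l * p ^ m \<noteq> 1"
    using mult_power_less_one[OF assms, of "l + m"] by (simp add: power_add mult.assoc)
  then show ?thesis
    by (simp add: norm_coef_def qpoch_Suc mult_ac)
qed

lemma norm_coef_shift:
  assumes "0 < p" "p < 1" "0 < y" "y < 1"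
  shows "norm_coef p (y * p) l m = norm_coef p y l m *
    ((1 - y * p) * p ^ m * (1 - y * p ^ l * p ^ m) * (1 - y)
      / ((1 - y * p ^ l * p ^ m * p) * (1 - y * p ^ l) * (1 - y * p ^ m)))"
proof -
  have "y * p ^ l * p ^ m \<noteq> 1"
    using mult_power_less_one[OF assms, of "l + m"] by (simp add: power_add mult.assoc)
  moreover have "qpoch (y * p) p n = qpoch y p n * (1 - y * p ^ n) / (1 - y)" for n
    using qpoch_shift[of y p n] assms by (simp add: nonzero_eq_divide_eq mult_ac)
  ultimately show ?thesis
    using assms by (simp add: norm_coef_def power_mult_distrib mult_ac)
qed

text \<open>These are the quotients met when multiplication by A is compared with the recurrence:
  each coefficient for l against the one for l + 1 to which it contributes, and, third, the one for
  m - 1. Writing l = r + j and m = s + k avoids truncated subtraction. The factor with R * U = p ^ l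
  is common to all four.\<close>

lemma acoef_ratios:
  fixes p x :: real and j k r s :: nat
  assumes p: "0 < p" "p < 1" and x: "0 < x" "x < 1"
  defines "R \<equiv> p ^ r" and "S \<equiv> p ^ s" and "U \<equiv> p ^ j" and "V \<equiv> p ^ k" and "z \<equiv> x * p ^ r * p ^ s"
  shows "acoef p x (r + j) (s + k) r s = acoef p x (Suc (r + j)) (s + k) r s *
      ((1 - x * p * (R * U)) * (1 - U * p) / ((1 - R * U * p) * (1 - z * p * U)))" (is ?A)
    and "acoef p x (r + j) (Suc (s + k)) r (Suc s) = acoef p x (Suc (r + j)) (Suc (s + k)) r s *
      ((1 - x * p * (R * U)) * (R * S * p * (1 - U * p) * (1 - V * p) * (1 - x * S))
        / ((1 - R * U * p) * (V * (1 - z) * (1 - z * p) * (1 - S * p))))" (is ?C)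
    and "acoef p x (r + j) (s + k) r s = acoef p x (Suc (r + j)) (Suc (s + k)) r s *
      ((1 - x * p * (R * U)) * (R * S * (1 - U * p) * (1 - V * p) * (1 - x * p * (S * V)))
        / ((1 - R * U * p) * ((1 - z * p * U) * (1 - z * p * V) * (1 - S * V * p))))" (is ?D)
    and "acoef p x (r + j) (s + k) r s = acoef p x (Suc (r + j)) (s + k) (Suc r) s *
      ((1 - x * p * (R * U)) * ((1 - z) * (1 - z * p) * V * (1 - R * p))
        / ((1 - R * U * p) * ((1 - z * p * U) * (1 - z * p * V) * (1 - x * R))))" (is ?B)
proof -
  define A0 where "A0 = 1 - x * p * (R * U) * (S * V)"
  define A1 where "A1 = 1 - x * p * (R * U) * (S * V) * p"
  define A2 where "A2 = 1 - x * p * (R * U) * (S * V) * p * p"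
  define Gn where "Gn = 1 - x * p * (R * U)"
  define Gd where "Gd = 1 - R * U * p"
  define z0 where "z0 = 1 - z"
  define z1 where "z1 = 1 - z * p"
  define z2 where "z2 = 1 - z * p * p"
  define zu where "zu = 1 - z * p * U"
  define zv where "zv = 1 - z * p * V"
  define u1 where "u1 = 1 - U * p"
  define v1 where "v1 = 1 - V * p"
  define r1 where "r1 = 1 - R * p"
  define s1 where "s1 = 1 - S * p"
  define m1 where "m1 = 1 - S * V * p"
  define xm where "xm = 1 - x * p * (S * V)"
  define xr where "xr = 1 - x * R"
  define xs where "xs = 1 - x * S"
  note defs = A0_def A1_def A2_def Gn_def Gd_def z0_def z1_def z2_def zu_def zv_def u1_def v1_def
    r1_def s1_def m1_def xm_def xr_def xs_def R_def S_def U_def V_def z_def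
  \<comment> \<open>Apart from the pure powers, every named factor has the form 1 - x p^n or 1 - p
    p^n, so a suitable n shows that it does not vanish.\<close>
  have mono: "x * p ^ n \<noteq> 1" "p * p ^ n \<noteq> 1" for n
    using mult_power_less_one[OF p x, of n] mult_power_less_one[OF p p, of n] by auto
  have ne: "A0 \<noteq> 0" "A1 \<noteq> 0" "A2 \<noteq> 0" "Gn \<noteq> 0" "Gd \<noteq> 0" "z0 \<noteq> 0" "z1 \<noteq> 0" "z2 \<noteq> 0" "zu \<noteq> 0" "zv \<noteq> 0"
    "u1 \<noteq> 0" "v1 \<noteq> 0" "r1 \<noteq> 0" "s1 \<noteq> 0" "m1 \<noteq> 0" "xm \<noteq> 0" "xr \<noteq> 0" "xs \<noteq> 0" "R \<noteq> 0" "S \<noteq> 0" "V \<noteq> 0"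
    using mono(1)[of "Suc (r + j + s + k)"] mono(1)[of "Suc (Suc (r + j + s + k))"]
      mono(1)[of "Suc (Suc (Suc (r + j + s + k)))"] mono(1)[of "Suc (r + j)"] mono(2)[of "r + j"]
      mono(1)[of "r + s"] mono(1)[of "Suc (r + s)"] mono(1)[of "Suc (Suc (r + s))"]
      mono(1)[of "Suc (r + s + j)"] mono(1)[of "Suc (r + s + k)"] mono(2)[of j] mono(2)[of k]
      mono(2)[of r] mono(2)[of s] mono(2)[of "s + k"] mono(1)[of "Suc (s + k)"] mono(1)[of r] mono(1)[of s] p
    by (simp_all add: defs power_add mult_ac)
  have xp: "0 < x * p" "x * p < 1"
    using p x mult_less_one[of x p] by auto
  have z: "0 < z * p" "z * p < 1"
    using p x mult_power_less_one[OF p xp, of "r + s"] by (simp_all add: z_def power_add mult_ac)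
  define c1 where "c1 = norm_coef p (x * p) (r + j) (s + k)"
  define c2 where "c2 = norm_coef p (z * p) j k"
  define c3 where "c3 = norm_coef p x r s"
  define w where "w = 1 - x * p"
  have pos: "c1 \<noteq> 0" "c2 \<noteq> 0" "c3 \<noteq> 0" "w \<noteq> 0"
    using norm_coef_pos[OF p xp, of "r + j" "s + k"] norm_coef_pos[OF p z, of j k] norm_coef_pos[OF p x, of r s] xp
    by (simp_all add: c1_def c2_def c3_def w_def)
  have eqs: "1 - x * p * p ^ (r + j) * p ^ (s + k) = A0" "1 - x * p * p ^ (r + j) * p ^ (s + k) * p = A1"
    "1 - x * p * p ^ Suc (r + j) * p ^ (s + k) = A1" "1 - x * p * p ^ Suc (r + j) * p ^ (s + k) * p = A2"
    "1 - x * p * p ^ (r + j) * p ^ Suc (s + k) = A1" "1 - x * p * p ^ (r + j) * p ^ Suc (s + k) * p = A2"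
    "1 - z * p * p ^ j * p ^ k = A0" "1 - z * p * p ^ j * p ^ k * p = A1"
    "1 - z * p * p ^ Suc j * p ^ k = A1" "1 - z * p * p ^ Suc j * p ^ k * p = A2"
    "1 - z * p * p ^ j * p ^ Suc k = A1" "1 - z * p * p ^ j * p ^ Suc k * p = A2"
    "1 - x * p * p ^ (r + j) = Gn" "1 - p ^ (r + j) * p = Gd" "1 - p ^ (s + k) * p = m1" "1 - x * p * p ^ (s + k) = xm"
    "1 - z * p * p ^ j = zu" "1 - z * p * p ^ k = zv" "1 - p ^ j * p = u1" "1 - p ^ k * p = v1"
    "1 - x * p ^ r * p ^ s = z0" "1 - x * p ^ r * p ^ s * p = z1" "1 - z * p = z1" "1 - z * p * p = z2"
    "1 - p ^ r * p = r1" "1 - x * p ^ r = xr" "1 - p ^ s * p = s1" "1 - x * p ^ s = xs"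
    by (simp_all add: defs power_add mult_ac)
  have C1l: "norm_coef p (x * p) (Suc (r + j)) (s + k) = c1 * (A0 * Gd / (A1 * Gn))"
    using norm_coef_Suc_left[OF p xp, of "r + j" "s + k"] by (simp only: eqs c1_def)
  have C1r: "norm_coef p (x * p) (r + j) (Suc (s + k)) = c1 * (x * p * A0 * m1 / (A1 * xm))"
    using norm_coef_Suc_right[OF p xp, of "r + j" "s + k"] by (simp only: eqs c1_def)
  have C1lr: "norm_coef p (x * p) (Suc (r + j)) (Suc (s + k)) = norm_coef p (x * p) (r + j) (Suc (s + k)) * (A1 * Gd / (A2 * Gn))"
    using norm_coef_Suc_left[OF p xp, of "r + j" "Suc (s + k)"] by (simp only: eqs)
  have C2l: "norm_coef p (z * p) (Suc j) k = c2 * (A0 * u1 / (A1 * zu))"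
    using norm_coef_Suc_left[OF p z, of j k] by (simp only: eqs c2_def)
  have C2lr: "norm_coef p (z * p) (Suc j) (Suc k) = c2 * (z * p * A0 * v1 / (A1 * zv)) * (A1 * u1 / (A2 * zu))"
    using norm_coef_Suc_left[OF p z, of j "Suc k"] norm_coef_Suc_right[OF p z, of j k] by (simp only: eqs c2_def)
  have C2s: "norm_coef p (z * p * p) j k = c2 * (z2 * V * A0 * z1 / (A1 * zu * zv))"
    using norm_coef_shift[OF p z, of j k] by (simp only: eqs c2_def V_def)
  have C3l: "norm_coef p x (Suc r) s = c3 * (z0 * r1 / (z1 * xr))"
    using norm_coef_Suc_left[OF p x, of r s] by (simp only: eqs c3_def)
  have C3r: "norm_coef p x r (Suc s) = c3 * (x * z0 * s1 / (z1 * xs))"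
    using norm_coef_Suc_right[OF p x, of r s] by (simp only: eqs c3_def)
  have zz: "x * p ^ Suc r * p ^ s * p = z * p * p" "x * p ^ r * p ^ Suc s * p = z * p * p" "x * p ^ r * p ^ s * p = z * p"
    by (simp_all add: z_def)
  have zRS: "z = x * R * S"
    by (simp add: z_def R_def S_def)
  have sub: "r + j - r = j" "s + k - s = k" "Suc (r + j) - r = Suc j" "Suc (s + k) - s = Suc k"
    "Suc (s + k) - Suc s = k" "Suc (r + j) - Suc r = j"
    by auto
  have base: "acoef p x (r + j) (s + k) r s = z1 / w * c1 / (c2 * c3)"
    unfolding acoef_def zz sub by (simp only: eqs(23) w_def c1_def c2_def c3_def)
  have "acoef p x (Suc (r + j)) (s + k) r s = z1 / w * (c1 * (A0 * Gd / (A1 * Gn))) / ((c2 * (A0 * u1 / (A1 * zu))) * c3)"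
    unfolding acoef_def zz sub C1l C2l by (simp only: eqs(23) w_def c3_def)
  then show ?A
    unfolding base using ne pos by (simp add: Gn_def[symmetric] Gd_def[symmetric] u1_def[symmetric] zu_def[symmetric])
  have "acoef p x (Suc (r + j)) (s + k) (Suc r) s = z2 / w * (c1 * (A0 * Gd / (A1 * Gn))) /
      (c2 * (z2 * V * A0 * z1 / (A1 * zu * zv)) * (c3 * (z0 * r1 / (z1 * xr))))"
    unfolding acoef_def zz sub C1l C2s C3l by (simp only: eqs(24) w_def)
  then show ?B
    unfolding base using ne pos
    by (simp add: Gn_def[symmetric] Gd_def[symmetric] r1_def[symmetric] zu_def[symmetric] zv_def[symmetric]
      z0_def[symmetric] z1_def[symmetric] xr_def[symmetric])
  have T: "acoef p x (Suc (r + j)) (Suc (s + k)) r s = z1 / w * (c1 * (x * p * A0 * m1 / (A1 * xm)) * (A1 * Gd / (A2 * Gn))) /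
      ((c2 * (z * p * A0 * v1 / (A1 * zv)) * (A1 * u1 / (A2 * zu))) * c3)"
    unfolding acoef_def zz sub C1lr C1r C2lr by (simp only: eqs(23) w_def c3_def)
  then show ?D
    unfolding base using ne pos x p
    by (simp add: Gn_def[symmetric] Gd_def[symmetric] zu_def[symmetric] zv_def[symmetric] u1_def[symmetric]
      v1_def[symmetric] m1_def[symmetric] xm_def[symmetric]) (simp add: zRS)
  have "acoef p x (r + j) (Suc (s + k)) r (Suc s) = z2 / w * (c1 * (x * p * A0 * m1 / (A1 * xm))) /
      (c2 * (z2 * V * A0 * z1 / (A1 * zu * zv)) * (c3 * (x * z0 * s1 / (z1 * xs))))"
    unfolding acoef_def zz sub C1r C2s C3r by (simp only: eqs(24) w_def)
  with T show ?C
    using ne pos x p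
    by (simp add: Gn_def[symmetric] Gd_def[symmetric] u1_def[symmetric]
      v1_def[symmetric] s1_def[symmetric] xs_def[symmetric] z0_def[symmetric] z1_def[symmetric]) (simp add: zRS mult_ac)
qed

text \<open>
  The extension by zero outside the range of summation; with it the relations between
  neighbouring coefficients have no exceptional cases at the boundary.
\<close>

definition acoef0 :: "real \<Rightarrow> real \<Rightarrow> nat \<Rightarrow> nat \<Rightarrow> nat \<Rightarrow> nat \<Rightarrow> real" where
  "acoef0 p x l m r s = (if r \<le> l \<and> s \<le> m then acoef p x l m r s else 0)"

text \<open>\<open>G\<close> is chosen so that all five right-hand sides become \<open>G\<close>
  times a rational function of u, v, z, R and p; the relation between the coefficients then no
  longer involves \<open>acoef\<close>. The square in the third one is kept apart because it cancels
  against the scalar of the lowering formula.\<close>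

lemma acoef0_neighbours:
  fixes p x :: real and l m r s :: nat
  assumes p: "0 < p" "p < 1" and x: "0 < x" "x < 1" and rs: "r \<le> Suc l" "s \<le> m"
  defines "R \<equiv> p ^ r" and "S \<equiv> p ^ s" and "u \<equiv> p ^ (Suc l - r)" and "v \<equiv> p ^ (m - s)"
    and "z \<equiv> x * p ^ r * p ^ s"
  defines "d \<equiv> 1 - z * u * v"
  defines "G \<equiv> acoef p x (Suc l) m r s * ((1 - x * u * R) / (1 - u * R))"
  shows "acoef0 p x l m r s = G * ((1 - u) / (1 - z * u))"
    and "(if r = 0 then 0 else acoef0 p x l m (r - 1) s * ((1 - x * p ^ (r - 1)) / (1 - x * p ^ (r - 1) * S)) * (u / v))
       = G * (u * (1 - R) * (1 - z) / ((1 - z * u) * (1 - z * v)))"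
    and "acoef0 p x l m r (Suc s) * (x * R * (1 - S * p) / (1 - x * R * (S * p))) * (u / v)
       = G * (z * u * (1 - u) * (1 - v) * (R - z) / (1 - z)) * (p / (v * (1 - z * p))) ^ 2"
    and "(1 - x * R * u) / d * acoef p x (Suc l) m r s = G * ((1 - u * R) / d)"
    and "x * R * u * (1 - v * S) / d * acoef0 p x l (m - 1) r s
       = G * (z * u * (R - z * v) * (1 - u) * (1 - v) / ((1 - z * u) * (1 - z * v) * d))"
proof -
  have mono: "x * p ^ n \<noteq> 1" "p * p ^ n \<noteq> 1" for n
    using mult_power_less_one[OF p x, of n] mult_power_less_one[OF p p, of n] by auto
  have uR: "u * R = p * p ^ l"
    using rs by (simp add: u_def R_def flip: power_add power_Suc)
  have ne: "1 - z \<noteq> 0" "1 - z * p \<noteq> 0" "1 - z * u \<noteq> 0" "1 - z * v \<noteq> 0" "1 - u * R \<noteq> 0" "u \<noteq> 0" "v \<noteq> 0" "R \<noteq> 0" "S \<noteq> 0" "p \<noteq> 0"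
    using p mono(1)[of "r + s"] mono(1)[of "Suc (r + s)"] mono(1)[of "r + s + (Suc l - r)"] mono(1)[of "r + s + (m - s)"] mono(2)[of l]
    unfolding uR by (simp_all add: u_def v_def R_def S_def z_def power_add mult_ac)
  have zxRS: "z = x * R * S"
    by (simp add: z_def R_def S_def)
  show 1: "acoef0 p x l m r s = G * ((1 - u) / (1 - z * u))"
  proof (cases "r = Suc l")
    case True
    then show ?thesis by (simp add: acoef0_def u_def)
  next
    case False
    with rs obtain j where l: "l = r + j" by (metis le_SucE nat_le_iff_add)
    from rs obtain k where m: "m = s + k" by (metis nat_le_iff_add)
    have up: "u = p ^ j * p"
      by (simp add: u_def l Suc_diff_le)
    show ?thesis
      using acoef_ratios(1)[OF p x, of r j s k]
      by (simp add: acoef0_def G_def l m up R_def z_def mult_ac)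
  qed
  show 2: "(if r = 0 then 0 else acoef0 p x l m (r - 1) s * ((1 - x * p ^ (r - 1)) / (1 - x * p ^ (r - 1) * S)) * (u / v))
       = G * (u * (1 - R) * (1 - z) / ((1 - z * u) * (1 - z * v)))"
  proof (cases r)
    case 0
    then show ?thesis by (simp add: R_def)
  next
    case (Suc r')
    with rs obtain J where l: "l = r' + J" by (metis Suc_le_mono nat_le_iff_add)
    from rs obtain k where m: "m = s + k" by (metis nat_le_iff_add)
    define z' where "z' = x * p ^ r' * S"
    have uJ: "u = p ^ J" and vk: "v = p ^ k" and Rr: "R = p ^ r' * p" and zp: "z = z' * p"
      by (simp_all add: u_def v_def R_def S_def z_def z'_def l m Suc)
    have ne': "1 - z' \<noteq> 0" "1 - x * p ^ r' \<noteq> 0"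
      using mono(1)[of "r' + s"] mono(1)[of r'] by (simp_all add: z'_def S_def power_add mult_ac)
    have "acoef p x (r' + J) (s + k) r' s = acoef p x (Suc l) m r s *
      ((1 - x * u * R) * ((1 - z') * (1 - z) * v * (1 - R)) / ((1 - u * R) * ((1 - z * u) * (1 - z * v) * (1 - x * p ^ r'))))"
      using acoef_ratios(4)[OF p x, of r' J s k] unfolding l m Suc uJ vk Rr zp z'_def S_def
      by (simp add: mult_ac)
    then have "acoef0 p x l m r' s * ((1 - x * p ^ r') / (1 - z')) * (u / v) =
       acoef p x (Suc l) m r s *
      ((1 - x * u * R) * ((1 - z') * (1 - z) * v * (1 - R)) / ((1 - u * R) * ((1 - z * u) * (1 - z * v) * (1 - x * p ^ r'))))
       * ((1 - x * p ^ r') / (1 - z')) * (u / v)"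
      by (simp add: acoef0_def l m)
    also have "\<dots> = G * (u * (1 - R) * (1 - z) / ((1 - z * u) * (1 - z * v)))"
      unfolding G_def using ne ne' by simp
    finally show ?thesis
      by (simp add: Suc z'_def)
  qed
  show 3: "acoef0 p x l m r (Suc s) * (x * R * (1 - S * p) / (1 - x * R * (S * p))) * (u / v)
       = G * (z * u * (1 - u) * (1 - v) * (R - z) / (1 - z)) * (p / (v * (1 - z * p))) ^ 2"
  proof (cases "r = Suc l \<or> s = m")
    case True
    then show ?thesis by (auto simp: acoef0_def u_def v_def)
  next
    case False
    with rs obtain j where l: "l = r + j" by (metis le_SucE nat_le_iff_add)
    from False rs obtain k where m: "m = Suc (s + k)" by (metis less_imp_Suc_add order_le_less)
    have up: "u = p ^ j * p" and vp: "v = p ^ k * p"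
      by (simp_all add: u_def v_def l m Suc_diff_le)
    have ne': "1 - S * p \<noteq> 0" "p ^ k \<noteq> 0"
      using mono(2)[of s] p by (simp_all add: S_def mult_ac)
    have "acoef p x (r + j) (Suc (s + k)) r (Suc s) = acoef p x (Suc l) m r s *
      ((1 - x * u * R) * (R * S * p * (1 - u) * (1 - v) * (1 - x * S))
        / ((1 - u * R) * (p ^ k * (1 - z) * (1 - z * p) * (1 - S * p))))"
      using acoef_ratios(2)[OF p x, of r j s k] unfolding l m up vp R_def z_def S_def
      by (simp add: mult_ac)
    then have "acoef0 p x l m r (Suc s) * (x * R * (1 - S * p) / (1 - z * p)) * (u / v) =
      acoef p x (Suc l) m r s *
      ((1 - x * u * R) * (R * S * p * (1 - u) * (1 - v) * (1 - x * S))
        / ((1 - u * R) * (p ^ k * (1 - z) * (1 - z * p) * (1 - S * p)))) * (x * R * (1 - S * p) / (1 - z * p)) * (u / v)"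
      by (simp add: acoef0_def l m)
    also have "\<dots> = G * (z * u * (1 - u) * (1 - v) * (R * (1 - x * S)) / (1 - z)) * (p / (v * (1 - z * p))) ^ 2"
      unfolding G_def vp using ne ne' by (simp add: power2_eq_square zxRS) (simp add: mult_ac)
    also have "R * (1 - x * S) = R - z"
      by (simp add: zxRS algebra_simps)
    finally show ?thesis
      by (simp add: zxRS mult_ac)
  qed
  show "(1 - x * R * u) / d * acoef p x (Suc l) m r s = G * ((1 - u * R) / d)"
    unfolding G_def using ne by (simp add: mult_ac)
  show "x * R * u * (1 - v * S) / d * acoef0 p x l (m - 1) r s
       = G * (z * u * (R - z * v) * (1 - u) * (1 - v) / ((1 - z * u) * (1 - z * v) * d))"
  proof (cases "r = Suc l \<or> s = m")
    \<comment> \<open>If m = 0, the truncated m - 1 is harmless because v * S = p ^ m = 1. Otherwise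
      (r, s) is out of range for \<open>acoef0\<close>, and 1 - u or 1 - v vanishes on the
      right.\<close>
    case True
    then show ?thesis by (cases "m = 0") (auto simp: acoef0_def u_def v_def S_def)
  next
    case False
    with rs obtain j where l: "l = r + j" by (metis le_SucE nat_le_iff_add)
    from False rs obtain k where m: "m = Suc (s + k)" by (metis less_imp_Suc_add order_le_less)
    have up: "u = p ^ j * p" and vp: "v = p ^ k * p"
      by (simp_all add: u_def v_def l m Suc_diff_le)
    have ne': "1 - S * v \<noteq> 0"
      using mono(2)[of "s + k"] p by (simp add: S_def vp power_add mult_ac)
    have "acoef p x (r + j) (s + k) r s = acoef p x (Suc l) m r s *
      ((1 - x * u * R) * (R * S * (1 - u) * (1 - v) * (1 - x * (S * v)))
        / ((1 - u * R) * ((1 - z * u) * (1 - z * v) * (1 - S * v))))"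
      using acoef_ratios(3)[OF p x, of r j s k] unfolding l m up vp R_def z_def S_def
      by (simp add: mult_ac)
    then have "x * R * u * (1 - S * v) / d * acoef0 p x l (m - 1) r s =
      x * R * u * (1 - S * v) / d * (acoef p x (Suc l) m r s *
      ((1 - x * u * R) * (R * S * (1 - u) * (1 - v) * (1 - x * (S * v)))
        / ((1 - u * R) * ((1 - z * u) * (1 - z * v) * (1 - S * v)))))"
      by (simp add: acoef0_def l m)
    also have "\<dots> = G * (z * u * (R * (1 - x * (S * v))) * (1 - u) * (1 - v) / ((1 - z * u) * (1 - z * v) * d))"
      unfolding G_def zxRS using ne[unfolded zxRS] ne' by (simp add: mult_ac)
    also have "R * (1 - x * (S * v)) = R - z * v"
      by (simp add: zxRS algebra_simps)
    finally show ?thesis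
      by (simp add: mult_ac)
  qed
qed

text \<open>
  \<open>w0\<close>, \<open>w1\<close>, \<open>w2\<close> are the normalised weights of the three contributions to one term of
  the sum for $l + 1$; the middle identity says that the mixed tensors cancel.
\<close>

lemma rational_identities:
  fixes u v z R :: real
  assumes "1 - z \<noteq> 0" "1 - z * u \<noteq> 0" "1 - z * v \<noteq> 0" "1 - z * u * v \<noteq> 0"
  defines "d \<equiv> 1 - z * u * v"
  defines "a \<equiv> (1 - z * u) / d" and "b \<equiv> z * u * (1 - v) / d"
    and "c \<equiv> (1 - z * u) * (1 - z * v) / (d * (1 - z))"
    and "e \<equiv> - (z * (1 - u) * (1 - v) / (d * (1 - z)))"
    and "w0 \<equiv> (1 - u) / (1 - z * u)"
    and "w1 \<equiv> u * (1 - R) * (1 - z) / ((1 - z * u) * (1 - z * v))"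
    and "w2 \<equiv> z * u * (1 - u) * (1 - v) * (R - z) / (1 - z) * (1 / d) ^ 2"
  shows "w0 * a ^ 2 + w1 * c ^ 2 + w2 = (1 - u * R) / d"
    and "w0 * (a * b) + w1 * (c * e) - w2 = 0"
    and "w0 * b ^ 2 + w1 * e ^ 2 + w2 = z * u * (R - z * v) * (1 - u) * (1 - v) / ((1 - z * u) * (1 - z * v) * d)"
proof -
  have ne: "1 - z \<noteq> 0" "1 - z * u \<noteq> 0" "1 - z * v \<noteq> 0" "d \<noteq> 0"
    using assms by (auto simp: d_def)
  show "w0 * a ^ 2 + w1 * c ^ 2 + w2 = (1 - u * R) / d"
    unfolding w0_def w1_def w2_def a_def c_def using ne
    by (simp add: divide_simps power2_eq_square) (simp add: d_def, algebra)
  \<comment> \<open>All three summands contain z u (1 - u) (1 - v) / d^2. What remains is 1 - (1 -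
    R) / (1 - z) - (R - z) / (1 - z) = 0, for any nonzero value of d.\<close>
  show "w0 * (a * b) + w1 * (c * e) - w2 = 0"
    unfolding w0_def w1_def w2_def a_def b_def c_def e_def using ne
    by (simp add: divide_simps power2_eq_square) algebra
  show "w0 * b ^ 2 + w1 * e ^ 2 + w2 = z * u * (R - z * v) * (1 - u) * (1 - v) / ((1 - z * u) * (1 - z * v) * d)"
    unfolding w0_def w1_def w2_def b_def e_def using ne
    by (simp add: divide_simps power2_eq_square) (simp add: d_def, algebra)
qed

section \<open>The two commuting algebras\<close>

text \<open>The tensor product is modelled by two families in one algebra that commute with each
  other; the elements a (x) 1 and 1 (x) b are an instance. The involution enters through the
  *-images contained in the relations.\<close>

locale q_disk_pair =
  fixes q \<alpha> :: real
    and x1 x1s x2 x2s Q y1 y1s y2 y2s D :: "'a::real_algebra_1"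
  assumes q: "0 < q" "q < 1"
    and \<alpha>: "\<alpha> > 0"
    and X: "X_rels q x1 x1s x2 x2s Q"
    and Y: "Y_rels q y1 y1s y2 y2s D"
    and comm: "\<forall>a\<in>{x1, x1s, x2, x2s, Q}. \<forall>b\<in>{y1, y1s, y2, y2s, D}. a * b = b * a"
begin

definition p :: real where "p = q\<^sup>2"

lemma p: "0 < p" "p < 1"
  using q by (auto simp: p_def power_less_one_iff)

definition W :: 'a where "W = Q - x2 * x2s"

lemma X_simps:
  "x1 * x2 = q *\<^sub>R (x2 * x1)" "x2s * x1s = q *\<^sub>R (x1s * x2s)"
  "x1s * x2 = q *\<^sub>R (x2 * x1s)" "x2s * x1 = q *\<^sub>R (x1 * x2s)"
  "x2s * x2 = p *\<^sub>R (x2 * x2s) + (1 - p) *\<^sub>R Q"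
  "x1s * x1 = p *\<^sub>R (x1 * x1s) + (1 - p) *\<^sub>R W"
  "Q * x1 = x1 * Q" "Q * x1s = x1s * Q" "Q * x2 = x2 * Q" "Q * x2s = x2s * Q"
  using X by (auto simp: X_rels_def p_def W_def scaleR_conv_of_real)

lemma Y_simps:
  "y1 * y2 = q *\<^sub>R (y2 * y1)" "y2s * y1s = q *\<^sub>R (y1s * y2s)"
  "y1s * y2 = q *\<^sub>R (y2 * y1s)" "y2s * y1 = q *\<^sub>R (y1 * y2s)"
  "y1 * y1s = y1s * y1" "y2 * y2s = D - y1 * y1s" "y2s * y2 = D - p *\<^sub>R (y1 * y1s)"
  using Y by (auto simp: Y_rels_def p_def scaleR_conv_of_real algebra_simps)

lemma xy_commute:
  "a \<in> {x1, x1s, x2, x2s, Q} \<Longrightarrow> b \<in> {y1, y1s, y2, y2s, D} \<Longrightarrow> b * a = a * b"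
  using comm by metis

lemma W_commute: "W * x1 = x1 * W" "W * x1s = x1s * W"
proof -
  have "x1 * (x2 * x2s) = q *\<^sub>R (x2 * (x1 * x2s))"
    using X_simps(1) by (simp flip: mult.assoc)
  also have "\<dots> = x2 * x2s * x1"
    using X_simps(4) by (simp add: mult.assoc)
  finally show "W * x1 = x1 * W"
    using X_simps(7) by (simp add: W_def algebra_simps)
  have "x2 * x2s * x1s = q *\<^sub>R (x2 * x1s * x2s)"
    using X_simps(2) by (simp add: mult.assoc)
  also have "\<dots> = x1s * (x2 * x2s)"
    using X_simps(3) by (simp flip: mult.assoc)
  finally show "W * x1s = x1s * W"
    using X_simps(8) by (simp add: W_def algebra_simps)
qed

text \<open>Centrality of D is not among the relations of Y but follows from its two expressions.
  Moving y2 or y2s past y1 y1s yields the factor p, which turns the first expression of D into the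
  second; for y1 and y1s the powers of q cancel.\<close>

lemma D_y1: "D * y1 = y1 * D" and D_y1s: "D * y1s = y1s * D"
  and D_y2: "D * y2 = y2 * D" and D_y2s: "D * y2s = y2s * D"
proof -
  have D1: "D = y1 * y1s + y2 * y2s" and D2: "D = p *\<^sub>R (y1 * y1s) + y2s * y2"
    using Y_simps(6,7) by auto
  have a: "y2 * y2s * y1 = y1 * (y2 * y2s)"
    using Y_simps(1,4) by (simp add: mult.assoc) (simp flip: mult.assoc)
  have b: "y2 * y2s * y1s = y1s * (y2 * y2s)"
    using Y_simps(2,3) by (simp add: mult.assoc) (simp flip: mult.assoc)
  have c: "y1 * y1s * y1 = y1 * (y1 * y1s)" "y1 * y1s * y1s = y1s * (y1 * y1s)"
    by (metis Y_simps(5) mult.assoc)+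
  show "D * y1 = y1 * D" unfolding D1 distrib_left distrib_right a c ..
  show "D * y1s = y1s * D" unfolding D1 distrib_left distrib_right b c ..
  have "y1 * y1s * y2 = p *\<^sub>R (y2 * (y1 * y1s))"
  proof -
    have "y1 * y1s * y2 = q *\<^sub>R (y1 * y2 * y1s)" using Y_simps(3) by (simp add: mult.assoc)
    then show ?thesis using Y_simps(1) by (simp add: p_def power2_eq_square mult.assoc)
  qed
  then have "D * y2 = p *\<^sub>R (y2 * (y1 * y1s)) + y2 * (y2s * y2)"
    by (subst D1) (simp add: distrib_right mult.assoc)
  also have "\<dots> = y2 * (p *\<^sub>R (y1 * y1s) + y2s * y2)"
    by (simp add: distrib_left)
  finally show "D * y2 = y2 * D" using D2 by simp
  have "y2s * (y1 * y1s) = p *\<^sub>R (y1 * y1s * y2s)"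
  proof -
    have "y2s * (y1 * y1s) = q *\<^sub>R (y1 * (y2s * y1s))" using Y_simps(4) by (simp flip: mult.assoc)
    then show ?thesis using Y_simps(2) by (simp add: p_def power2_eq_square mult.assoc)
  qed
  then have "y2s * D = p *\<^sub>R (y1 * y1s * y2s) + y2s * y2 * y2s"
    by (subst D1) (simp add: distrib_left mult.assoc)
  also have "\<dots> = (p *\<^sub>R (y1 * y1s) + y2s * y2) * y2s"
    by (simp add: distrib_right)
  finally show "D * y2s = y2s * D" using D2 by simp
qed

lemma qdisk_x1: "qdisk p x1 x1s W"
  using W_commute X_simps(6) by (simp add: qdisk_def)

lemma qdisk_x2: "qdisk p x2 x2s Q"
  using X_simps by (simp add: qdisk_def)

lemma qdisk_y2: "qdisk p y2 y2s D"
  unfolding qdisk_def Y_simps(6,7) using D_y2 D_y2s by (simp add: scaleR_diff_left scaleR_diff_right)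

section \<open>The left-hand arguments satisfy the disk relations\<close>

definition A :: 'a where "A = x2 * y2 - q *\<^sub>R (x1 * y1s)"
definition B :: 'a where "B = x2s * y2s - q *\<^sub>R (x1s * y1)"

text \<open>Mixed products pick up q from each tensor factor, hence p. Among the others, x2 y2 alone
  gives (1 - p) Q D with the surplus -p (1 - p) (Q - t) n. The part x1 y1s, weighted by (-q)^2 = p,
  cancels this surplus because Q - x2 x2s is the inhomogeneous term in the relation for x1s
  x1.\<close>

lemma qdisk_AB: "qdisk p A B (Q * D)"
proof -
  have sw: "(a * b) * (c * d) = (a * c) * (b * d)"
    if "b \<in> {y1, y1s, y2, y2s, D}" "c \<in> {x1, x1s, x2, x2s, Q}" for a b c d
    using xy_commute[OF that(2,1)] by (metis mult.assoc)
  have QD: "Q * D * (a * b) = a * b * (Q * D)" if "a \<in> {x1, x1s, x2, x2s}" "b \<in> {y1, y1s, y2, y2s}" for a b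
  proof -
    have "Q * D * (a * b) = Q * a * (D * b)" "a * b * (Q * D) = a * Q * (b * D)"
      using that by (intro sw; auto)+
    moreover have "Q * a = a * Q" "D * b = b * D"
      using that X_simps(7-10) D_y1 D_y1s D_y2 D_y2s by auto
    ultimately show ?thesis by simp
  qed
  have "Q * D * A = A * (Q * D)" "Q * D * B = B * (Q * D)"
    by (simp_all add: A_def B_def left_diff_distrib right_diff_distrib QD)
  moreover have "B * A = p *\<^sub>R (A * B) + (1 - p) *\<^sub>R (Q * D)"
  proof -
    define n where "n = y1 * y1s"
    define t where "t = x2 * x2s"
    have e1: "(x1s * y1) * (x2 * y2) = p *\<^sub>R ((x2 * y2) * (x1s * y1))"
      "(x2s * y2s) * (x1 * y1s) = p *\<^sub>R ((x1 * y1s) * (x2s * y2s))"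
      using X_simps(3,4) Y_simps(1,2) by (simp_all add: sw p_def power2_eq_square)
    have e2: "(x1 * y1s) * (x1s * y1) = (x1 * x1s) * n"
      "(x1s * y1) * (x1 * y1s) = p *\<^sub>R ((x1 * x1s) * n) + (1 - p) *\<^sub>R ((Q - t) * n)"
      using X_simps(6) Y_simps(5) by (simp_all add: sw n_def t_def distrib_right W_def)
    have e3: "(x2 * y2) * (x2s * y2s) = t * (D - n)"
      "(x2s * y2s) * (x2 * y2) = (p *\<^sub>R t + (1 - p) *\<^sub>R Q) * (D - p *\<^sub>R n)"
      using X_simps(5) Y_simps(6,7) by (simp_all add: sw n_def t_def)
    have AB: "A * B = t * (D - n) - q *\<^sub>R ((x2 * y2) * (x1s * y1)) - q *\<^sub>R ((x1 * y1s) * (x2s * y2s))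
       + p *\<^sub>R ((x1 * x1s) * n)"
      unfolding A_def B_def left_diff_distrib right_diff_distrib mult_scaleR_left mult_scaleR_right e2 e3
      by (simp add: p_def power2_eq_square algebra_simps)
    have BA: "B * A = (p *\<^sub>R t + (1 - p) *\<^sub>R Q) * (D - p *\<^sub>R n)
       - p *\<^sub>R q *\<^sub>R ((x2 * y2) * (x1s * y1)) - p *\<^sub>R q *\<^sub>R ((x1 * y1s) * (x2s * y2s))
       + p *\<^sub>R (p *\<^sub>R ((x1 * x1s) * n) + (1 - p) *\<^sub>R ((Q - t) * n))"
      unfolding A_def B_def left_diff_distrib right_diff_distrib mult_scaleR_left mult_scaleR_right e1 e2 e3
      by (simp add: p_def power2_eq_square algebra_simps)
    show ?thesis
      unfolding AB BA by (simp add: algebra_simps)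
  qed
  ultimately show ?thesis by (simp add: qdisk_def)
qed

section \<open>The tensor factors and their recurrences\<close>

definition XX :: "nat \<Rightarrow> nat \<Rightarrow> nat \<Rightarrow> 'a" where "XX n j k = Rdisk (\<alpha> + real n) j k x2 x2s Q p"
definition YY :: "nat \<Rightarrow> nat \<Rightarrow> nat \<Rightarrow> 'a" where "YY n j k = Rdisk (\<alpha> + real n) j k y2 y2s D p"
definition M :: "nat \<Rightarrow> nat \<Rightarrow> 'a" where "M r s = Rdisk (\<alpha> - 1) r s x1 x1s W p"
definition N :: "nat \<Rightarrow> nat \<Rightarrow> 'a" where "N r s = y1 ^ s * y1s ^ r"
definition T :: "nat \<Rightarrow> nat \<Rightarrow> 'a \<Rightarrow> 'a \<Rightarrow> 'a" where "T r s E F = (E * M r s) * (F * N r s)"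
definition x :: real where "x = p powr \<alpha>"

lemma x: "0 < x" "x < 1"
  using powr_in_unit_interval[OF p \<alpha>] by (auto simp: x_def)

lemma p_powr: "p powr (\<alpha> + real n + 1) = x * p ^ n * p"
  using p by (simp add: x_def powr_add powr_realpow)

lemma XX_left: "x2 * XX n j k =
    ((1 - x * p ^ n * p * p ^ j) / (1 - x * p ^ n * p * p ^ j * p ^ k)) *\<^sub>R XX n (Suc j) k
    + (x * p ^ n * p * p ^ j * (1 - p ^ k) / (1 - x * p ^ n * p * p ^ j * p ^ k)) *\<^sub>R (Q * XX n j (k - 1))"
  unfolding XX_def by (rule Rdisk_left[OF p _ qdisk_x2, of "\<alpha> + real n", unfolded p_powr]) (use \<alpha> in simp)

lemma YY_left: "y2 * YY n j k =
    ((1 - x * p ^ n * p * p ^ j) / (1 - x * p ^ n * p * p ^ j * p ^ k)) *\<^sub>R YY n (Suc j) k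
    + (x * p ^ n * p * p ^ j * (1 - p ^ k) / (1 - x * p ^ n * p * p ^ j * p ^ k)) *\<^sub>R (D * YY n j (k - 1))"
  unfolding YY_def by (rule Rdisk_left[OF p _ qdisk_y2, of "\<alpha> + real n", unfolded p_powr]) (use \<alpha> in simp)

lemma XX_raise: "XX n j k =
   ((1 - x * p ^ n * p * p ^ j) * (1 - x * p ^ n * p * p ^ k)
      / ((1 - x * p ^ n * p * p ^ j * p ^ k) * (1 - x * p ^ n * p))) *\<^sub>R XX (Suc n) j k
   - (x * p ^ n * p * (1 - p ^ j) * (1 - p ^ k)
      / ((1 - x * p ^ n * p * p ^ j * p ^ k) * (1 - x * p ^ n * p))) *\<^sub>R (Q * XX (Suc n) (j - 1) (k - 1))"
proof -
  have n: "\<alpha> + real (Suc n) = \<alpha> + real n + 1" by simp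
  show ?thesis
    unfolding XX_def n using Rdisk_raise[OF p _ qdisk_x2, of "\<alpha> + real n" j k, unfolded p_powr] \<alpha> by simp
qed

lemma YY_raise: "YY n j k =
   ((1 - x * p ^ n * p * p ^ j) * (1 - x * p ^ n * p * p ^ k)
      / ((1 - x * p ^ n * p * p ^ j * p ^ k) * (1 - x * p ^ n * p))) *\<^sub>R YY (Suc n) j k
   - (x * p ^ n * p * (1 - p ^ j) * (1 - p ^ k)
      / ((1 - x * p ^ n * p * p ^ j * p ^ k) * (1 - x * p ^ n * p))) *\<^sub>R (D * YY (Suc n) (j - 1) (k - 1))"
proof -
  have n: "\<alpha> + real (Suc n) = \<alpha> + real n + 1" by simp
  show ?thesis
    unfolding YY_def n using Rdisk_raise[OF p _ qdisk_y2, of "\<alpha> + real n" j k, unfolded p_powr] \<alpha> by simp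
qed

lemma XX_lower: "XX (Suc n) j k * W =
   (p ^ k * (1 - x * p ^ n * p) / (1 - x * p ^ n * p * p ^ j * p ^ k * p)) *\<^sub>R (Q * XX n j k - XX n (Suc j) (Suc k))"
proof -
  have n: "\<alpha> + real (Suc n) = \<alpha> + real n + 1" by simp
  show ?thesis
    unfolding XX_def W_def n using Rdisk_lower[OF p _ qdisk_x2, of "\<alpha> + real n" j k, unfolded p_powr] \<alpha> by simp
qed

lemma YY_lower: "YY (Suc n) j k * (y1 * y1s) =
   (p ^ k * (1 - x * p ^ n * p) / (1 - x * p ^ n * p * p ^ j * p ^ k * p)) *\<^sub>R (D * YY n j k - YY n (Suc j) (Suc k))"
proof -
  have n: "\<alpha> + real (Suc n) = \<alpha> + real n + 1" and W: "y1 * y1s = D - y2 * y2s"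
    using Y_simps(6) by simp_all
  show ?thesis
    unfolding YY_def n W using Rdisk_lower[OF p _ qdisk_y2, of "\<alpha> + real n" j k, unfolded p_powr] \<alpha> by simp
qed

lemma M_left: "x1 * M r s =
    ((1 - x * p ^ r) / (1 - x * p ^ r * p ^ s)) *\<^sub>R M (Suc r) s
    + (x * p ^ r * (1 - p ^ s) / (1 - x * p ^ r * p ^ s)) *\<^sub>R (W * M r (s - 1))"
  unfolding M_def using Rdisk_left[OF p _ qdisk_x1, of "\<alpha> - 1" r s] \<alpha> by (simp add: x_def)

lemma x1_XX: "x1 * XX n j k = (q ^ j / q ^ k) *\<^sub>R (XX n j k * x1)"
proof -
  have "q ^ k *\<^sub>R (x1 * XX n j k) = q ^ j *\<^sub>R (XX n j k * x1)"
    unfolding XX_def using X_simps by (intro Rdisk_skew_commute) auto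
  then have "(1 / q ^ k) *\<^sub>R (q ^ k *\<^sub>R (x1 * XX n j k)) = (1 / q ^ k) *\<^sub>R (q ^ j *\<^sub>R (XX n j k * x1))"
    by simp
  then show ?thesis using q by simp
qed

lemma y1s_YY: "y1s * YY n j k = (q ^ j / q ^ k) *\<^sub>R (YY n j k * y1s)"
proof -
  have "q ^ k *\<^sub>R (y1s * YY n j k) = q ^ j *\<^sub>R (YY n j k * y1s)"
    unfolding YY_def using Y_simps(2,3) D_y2 D_y1s by (intro Rdisk_skew_commute) auto
  then have "(1 / q ^ k) *\<^sub>R (q ^ k *\<^sub>R (y1s * YY n j k)) = (1 / q ^ k) *\<^sub>R (q ^ j *\<^sub>R (YY n j k * y1s))"
    by simp
  then show ?thesis using q by simp
qed

lemma W_xy_commute: "b \<in> {y1, y1s, y2, y2s, D} \<Longrightarrow> b * W = W * b"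
  using xy_commute[of Q b] xy_commute[of x2 b] xy_commute[of x2s b]
  by (simp add: W_def right_diff_distrib left_diff_distrib) (metis mult.assoc)

lemma XX_commute: "b \<in> {y1, y1s, y2, y2s, D} \<Longrightarrow> b * XX n j k = XX n j k * b"
  unfolding XX_def using xy_commute X_simps(9) by (intro Rdisk_commute) auto

lemma M_commute: "b \<in> {y1, y1s, y2, y2s, D} \<Longrightarrow> b * M r s = M r s * b"
  unfolding M_def using xy_commute W_commute W_xy_commute by (intro Rdisk_commute) auto

lemma mult_T:
  assumes "b \<in> {y1, y1s, y2, y2s, D}" "b * E = E * b"
  shows "(a * b) * T r s E F = (a * E * M r s) * (b * F * N r s)"
proof -
  have "b * (E * M r s) = E * M r s * b"
    using assms(2) M_commute[OF assms(1), of r s] by (metis mult.assoc)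
  then show ?thesis
    unfolding T_def by (metis mult.assoc)
qed

lemma N_Suc_left: "y1s * N r s = N (Suc r) s"
proof -
  have "y1s * y1 ^ s = y1 ^ s * y1s"
    using Y_simps(5) by (metis power_commute_left)
  then show ?thesis
    by (simp add: N_def) (simp flip: mult.assoc)
qed

lemma N_Suc_Suc: "N (Suc r) (Suc s) = y1 * y1s * N r s"
  by (metis N_Suc_left N_def mult.assoc power_Suc)

end

section \<open>Recurrence of the right-hand side\<close>

context q_disk_pair
begin

text \<open>For (a, b) = (1, 0) this is the tensor of the summand (r, s) for (l + 1, m), for (0, 1)
  it is Q D times the one for (l, m - 1): the two sums on the right of the recurrence to be
  proved.\<close>

definition V :: "nat \<Rightarrow> nat \<Rightarrow> nat \<Rightarrow> nat \<Rightarrow> real \<Rightarrow> real \<Rightarrow> 'a" where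
  "V l m r s a b = T r s
     (a *\<^sub>R XX (r + s) (Suc l - r) (m - s) + b *\<^sub>R (Q * XX (r + s) (l - r) (m - s - 1)))
     (a *\<^sub>R YY (r + s) (Suc l - r) (m - s) + b *\<^sub>R (D * YY (r + s) (l - r) (m - s - 1)))"

definition z :: "nat \<Rightarrow> nat \<Rightarrow> real" where "z r s = x * p ^ r * p ^ s"
definition u :: "nat \<Rightarrow> nat \<Rightarrow> real" where "u l r = p ^ (Suc l - r)"
definition v :: "nat \<Rightarrow> nat \<Rightarrow> real" where "v m s = p ^ (m - s)"
text \<open>In the range of summation z u v = x p^(l+m+1), so this is the denominator of the
  recurrence for parameter alpha, independent of r and s.\<close>

definition d :: "nat \<Rightarrow> nat \<Rightarrow> nat \<Rightarrow> nat \<Rightarrow> real" where "d l m r s = 1 - z r s * u l r * v m s"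

definition \<theta> :: "nat \<Rightarrow> nat \<Rightarrow> real" where "\<theta> r s = (- q) powi (int r - int s)"

text \<open>The weight (-q)^(r-s) is made for this: the scalar -q in front of X1 (x) Y1* is absorbed
  by either move, r to r + 1 or s to s - 1.\<close>

lemma \<theta>_Suc_left: "\<theta> (Suc r) s = - q * \<theta> r s"
  using q power_int_add_1[of "- q" "int r - int s"] by (simp add: \<theta>_def algebra_simps)

lemma \<theta>_Suc_right: "- q * \<theta> r (Suc s) = \<theta> r s"
  using q power_int_add_1[of "- q" "int r - int (Suc s)"] by (simp add: \<theta>_def algebra_simps)

section \<open>Action of the first argument on one summand\<close>

lemma x2_y2_term:
  assumes "r \<le> l" "s \<le> m"
  shows "(x2 * y2) * T r s (XX (r + s) (l - r) (m - s)) (YY (r + s) (l - r) (m - s)) =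
    V l m r s ((1 - z r s * u l r) / d l m r s) (z r s * u l r * (1 - v m s) / d l m r s)"
proof -
  have e: "x * p ^ (r + s) * p * p ^ (l - r) = z r s * u l r" "p ^ (m - s) = v m s" "Suc (l - r) = Suc l - r"
    using assms by (simp_all add: z_def u_def v_def power_add Suc_diff_le)
  have "(x2 * y2) * T r s (XX (r + s) (l - r) (m - s)) (YY (r + s) (l - r) (m - s)) =
    T r s (x2 * XX (r + s) (l - r) (m - s)) (y2 * YY (r + s) (l - r) (m - s))"
    by (subst mult_T) (auto simp: XX_commute T_def)
  then show ?thesis
    unfolding XX_left YY_left e V_def d_def .
qed

lemma raise_term:
  assumes "r \<le> l" "s \<le> m"
  shows "T (Suc r) s (XX (r + s) (l - r) (m - s)) (YY (r + s) (l - r) (m - s)) =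
    V l m (Suc r) s
      ((1 - z (Suc r) s * u l (Suc r)) * (1 - z (Suc r) s * v m s) / (d l m (Suc r) s * (1 - z (Suc r) s)))
      (- (z (Suc r) s * (1 - u l (Suc r)) * (1 - v m s) / (d l m (Suc r) s * (1 - z (Suc r) s))))"
proof -
  have e: "x * p ^ (r + s) * p = z (Suc r) s" "p ^ (m - s) = v m s" "p ^ (l - r) = u l (Suc r)"
    "Suc (r + s) = Suc r + s" "l - r - 1 = l - Suc r" "l - r = Suc l - Suc r"
    using assms by (simp_all add: z_def u_def v_def power_add mult_ac)
  have X: "XX (r + s) (l - r) (m - s) =
    ((1 - z (Suc r) s * u l (Suc r)) * (1 - z (Suc r) s * v m s) / (d l m (Suc r) s * (1 - z (Suc r) s))) *\<^sub>R
      XX (Suc r + s) (Suc l - Suc r) (m - s) +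
    (- (z (Suc r) s * (1 - u l (Suc r)) * (1 - v m s) / (d l m (Suc r) s * (1 - z (Suc r) s)))) *\<^sub>R
      (Q * XX (Suc r + s) (l - Suc r) (m - s - 1))"
    using XX_raise[of "r + s" "l - r" "m - s"] unfolding e(1-5) d_def[symmetric] by simp
  have Y: "YY (r + s) (l - r) (m - s) =
    ((1 - z (Suc r) s * u l (Suc r)) * (1 - z (Suc r) s * v m s) / (d l m (Suc r) s * (1 - z (Suc r) s))) *\<^sub>R
      YY (Suc r + s) (Suc l - Suc r) (m - s) +
    (- (z (Suc r) s * (1 - u l (Suc r)) * (1 - v m s) / (d l m (Suc r) s * (1 - z (Suc r) s)))) *\<^sub>R
      (D * YY (Suc r + s) (l - Suc r) (m - s - 1))"
    using YY_raise[of "r + s" "l - r" "m - s"] unfolding e(1-5) d_def[symmetric] by simp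
  show ?thesis
    unfolding V_def by (subst X, subst Y) (rule refl)
qed

lemma lower_term:
  assumes "r \<le> l" "Suc s \<le> m"
  defines "f \<equiv> v m s / p * (1 - z r s * p) / d l m r s"
  shows "T r s (XX (r + Suc s) (l - r) (m - Suc s) * W) (YY (r + Suc s) (l - r) (m - Suc s) * (y1 * y1s)) =
    V l m r s (- f) f"
proof -
  have uv: "v m s = p * p ^ (m - Suc s)" "u l r = p * p ^ (l - r)"
    using assms(1,2) by (simp_all add: u_def v_def Suc_diff_le Suc_diff_Suc flip: power_Suc)
  have e: "x * p ^ (r + s) * p = z r s * p" "p ^ (m - Suc s) = v m s / p" "z r s * p * p ^ (l - r) * (v m s / p) * p = z r s * u l r * v m s"
    "Suc (l - r) = Suc l - r" "Suc (m - Suc s) = m - s" "m - Suc s = m - s - 1"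
    using assms(1,2) p uv by (simp_all add: z_def power_add Suc_diff_le)
  have "XX (r + Suc s) (l - r) (m - Suc s) * W = f *\<^sub>R (Q * XX (r + s) (l - r) (m - Suc s) - XX (r + s) (Suc l - r) (m - s))"
    using XX_lower[of "r + s" "l - r" "m - Suc s"] unfolding e(1-5) d_def[symmetric] f_def by simp
  moreover have "YY (r + Suc s) (l - r) (m - Suc s) * (y1 * y1s) = f *\<^sub>R (D * YY (r + s) (l - r) (m - Suc s) - YY (r + s) (Suc l - r) (m - s))"
    using YY_lower[of "r + s" "l - r" "m - Suc s"] unfolding e(1-5) d_def[symmetric] f_def by simp
  ultimately show ?thesis
    unfolding V_def e(6) by (simp add: scaleR_diff_right)
qed

text \<open>Both defects appear together: the recurrence of \<open>M\<close> yields W times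
  \<open>M r (s - 1)\<close>, while y1s times \<open>N r s\<close> is y1 y1s times
  \<open>N r (s - 1)\<close>. For s = 0 the scalar 1 - p ^ s vanishes.\<close>

lemma x1_y1s_term:
  assumes "r \<le> l" "s \<le> m"
  shows "(x1 * y1s) * T r s (XX (r + s) (l - r) (m - s)) (YY (r + s) (l - r) (m - s)) =
    (p ^ (l - r) / p ^ (m - s)) *\<^sub>R
     (((1 - x * p ^ r) / (1 - x * p ^ r * p ^ s)) *\<^sub>R
        T (Suc r) s (XX (r + s) (l - r) (m - s)) (YY (r + s) (l - r) (m - s))
      + (x * p ^ r * (1 - p ^ s) / (1 - x * p ^ r * p ^ s)) *\<^sub>R
        (if s = 0 then 0
         else T r (s - 1) (XX (r + s) (l - r) (m - s) * W) (YY (r + s) (l - r) (m - s) * (y1 * y1s))))"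
proof -
  let ?X = "XX (r + s) (l - r) (m - s)" and ?Y = "YY (r + s) (l - r) (m - s)"
  \<comment> \<open>One factor comes from moving x1 past \<open>XX\<close>, the other from moving
    y1s past \<open>YY\<close>.\<close>
  have pq: "(q ^ (l - r) / q ^ (m - s)) * (q ^ (l - r) / q ^ (m - s)) = p ^ (l - r) / p ^ (m - s)"
    by (simp add: p_def power2_eq_square power_mult_distrib)
  have "(x1 * y1s) * T r s ?X ?Y = (x1 * ?X * M r s) * (y1s * ?Y * N r s)"
    by (rule mult_T) (auto simp: XX_commute)
  also have "\<dots> = (p ^ (l - r) / p ^ (m - s)) *\<^sub>R ((?X * (x1 * M r s)) * (?Y * (y1s * N r s)))"
    unfolding x1_XX y1s_YY by (simp add: pq[symmetric] mult.assoc)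
  also have "(?X * (x1 * M r s)) * (?Y * (y1s * N r s)) =
     ((1 - x * p ^ r) / (1 - x * p ^ r * p ^ s)) *\<^sub>R T (Suc r) s ?X ?Y
      + (x * p ^ r * (1 - p ^ s) / (1 - x * p ^ r * p ^ s)) *\<^sub>R (?X * (W * M r (s - 1)) * (?Y * N (Suc r) s))"
    unfolding M_left N_Suc_left T_def by (simp add: distrib_left distrib_right mult.assoc)
  also have "(x * p ^ r * (1 - p ^ s) / (1 - x * p ^ r * p ^ s)) *\<^sub>R (?X * (W * M r (s - 1)) * (?Y * N (Suc r) s)) =
    (x * p ^ r * (1 - p ^ s) / (1 - x * p ^ r * p ^ s)) *\<^sub>R
        (if s = 0 then 0 else T r (s - 1) (?X * W) (?Y * (y1 * y1s)))"
    by (cases s) (simp_all add: T_def N_Suc_Suc mult.assoc)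
  finally show ?thesis .
qed

definition S :: "nat \<Rightarrow> nat \<Rightarrow> 'a" where
  "S l m = (\<Sum>r\<le>l. \<Sum>s\<le>m. (acoef p x l m r s * \<theta> r s) *\<^sub>R
     T r s (XX (r + s) (l - r) (m - s)) (YY (r + s) (l - r) (m - s)))"

text \<open>
  The contributions to the term $(r,s)$ at level $l+1$ that come from the terms $(r,s)$,
  $(r-1,s)$ and $(r,s+1)$ at level $l$.
\<close>

definition h0 :: "nat \<Rightarrow> nat \<Rightarrow> nat \<Rightarrow> nat \<Rightarrow> 'a" where
  "h0 l m r s = (\<theta> r s * acoef0 p x l m r s) *\<^sub>R
     V l m r s ((1 - z r s * u l r) / d l m r s) (z r s * u l r * (1 - v m s) / d l m r s)"

definition h1 :: "nat \<Rightarrow> nat \<Rightarrow> nat \<Rightarrow> nat \<Rightarrow> 'a" where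
  "h1 l m r s = (\<theta> r s * (if r = 0 then 0 else acoef0 p x l m (r - 1) s *
        ((1 - x * p ^ (r - 1)) / (1 - x * p ^ (r - 1) * p ^ s)) * (u l r / v m s))) *\<^sub>R
     V l m r s ((1 - z r s * u l r) * (1 - z r s * v m s) / (d l m r s * (1 - z r s)))
       (- (z r s * (1 - u l r) * (1 - v m s) / (d l m r s * (1 - z r s))))"

definition h2 :: "nat \<Rightarrow> nat \<Rightarrow> nat \<Rightarrow> nat \<Rightarrow> 'a" where
  "h2 l m r s = (\<theta> r s * (acoef0 p x l m r (Suc s) *
        (x * p ^ r * (1 - p ^ s * p) / (1 - x * p ^ r * (p ^ s * p))) * (u l r / v m s))) *\<^sub>R
     V l m r s (- (v m s / p * (1 - z r s * p) / d l m r s)) (v m s / p * (1 - z r s * p) / d l m r s)"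

lemma A_term:
  assumes "r \<le> l" "s \<le> m"
  shows "A * ((acoef p x l m r s * \<theta> r s) *\<^sub>R T r s (XX (r + s) (l - r) (m - s)) (YY (r + s) (l - r) (m - s)))
    = h0 l m r s + h1 l m (Suc r) s + (case s of 0 \<Rightarrow> 0 | Suc s' \<Rightarrow> h2 l m r s')"
proof -
  have k: "acoef p x l m r s = acoef0 p x l m r s"
    using assms by (simp add: acoef0_def)
  let ?T = "T r s (XX (r + s) (l - r) (m - s)) (YY (r + s) (l - r) (m - s))"
  have 1: "(\<theta> r s * acoef0 p x l m r s) *\<^sub>R (x2 * y2 * ?T) = h0 l m r s"
    unfolding h0_def x2_y2_term[OF assms] ..
  have uv: "u l (Suc r) = p ^ (l - r)" "v m s = p ^ (m - s)"
    by (simp_all add: u_def v_def)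
  have 2: "(\<theta> (Suc r) s * acoef0 p x l m r s * (p ^ (l - r) / p ^ (m - s)) * ((1 - x * p ^ r) / (1 - x * p ^ r * p ^ s))) *\<^sub>R
      T (Suc r) s (XX (r + s) (l - r) (m - s)) (YY (r + s) (l - r) (m - s)) = h1 l m (Suc r) s"
    unfolding h1_def raise_term[OF assms] uv by (simp add: mult_ac)
  have 3: "(- q * \<theta> r s * acoef0 p x l m r s * (p ^ (l - r) / p ^ (m - s)) * (x * p ^ r * (1 - p ^ s) / (1 - x * p ^ r * p ^ s))) *\<^sub>R
        (if s = 0 then 0
         else T r (s - 1) (XX (r + s) (l - r) (m - s) * W) (YY (r + s) (l - r) (m - s) * (y1 * y1s)))
      = (case s of 0 \<Rightarrow> 0 | Suc s' \<Rightarrow> h2 l m r s')"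
  proof (cases s)
    case (Suc s')
    have s': "Suc s' \<le> m" using assms Suc by simp
    have "p ^ (l - r) / p ^ (m - Suc s') = u l r / v m s'"
    proof -
      have "v m s' = p * p ^ (m - Suc s')" "u l r = p * p ^ (l - r)"
        using assms s' by (simp_all add: u_def v_def Suc_diff_le Suc_diff_Suc flip: power_Suc)
      then show ?thesis using p by simp
    qed
    then show ?thesis
      using lower_term[OF assms(1) s'] \<theta>_Suc_right[of r s'] unfolding Suc h2_def
      by (simp add: mult_ac)
  qed simp
  have "A * ((acoef p x l m r s * \<theta> r s) *\<^sub>R ?T) =
     (\<theta> r s * acoef0 p x l m r s) *\<^sub>R (x2 * y2 * ?T) + (- q * \<theta> r s * acoef0 p x l m r s) *\<^sub>R (x1 * y1s * ?T)"
    unfolding A_def k by (simp add: left_diff_distrib scaleR_diff_right mult.commute)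
  also have "(- q * \<theta> r s * acoef0 p x l m r s) *\<^sub>R (x1 * y1s * ?T) = h1 l m (Suc r) s + (case s of 0 \<Rightarrow> 0 | Suc s' \<Rightarrow> h2 l m r s')"
    unfolding x1_y1s_term[OF assms] 2[symmetric] 3[symmetric] scaleR_add_right scaleR_scaleR \<theta>_Suc_left
    by (simp only: mult.assoc)
  finally show ?thesis
    unfolding 1 by (simp add: add.assoc)
qed

text \<open>Reindexing by target. The terms added to reach a common range are zero:
  \<open>h0\<close> and \<open>h2\<close> at r = l + 1, \<open>h1\<close> at r = 0, and
  \<open>h2\<close> at s = m.\<close>

lemma A_S: "A * S l m = (\<Sum>r\<le>Suc l. \<Sum>s\<le>m. h0 l m r s + h1 l m r s + h2 l m r s)"
proof -
  have shift: "(\<Sum>s\<le>m. case s of 0 \<Rightarrow> 0 | Suc s' \<Rightarrow> h2 l m r s') = (\<Sum>s\<le>m. h2 l m r s)" for r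
  proof (cases m)
    case 0
    then show ?thesis by (simp add: h2_def acoef0_def)
  next
    case (Suc m')
    have "h2 l m r m = 0"
      by (simp add: h2_def acoef0_def)
    then show ?thesis
      unfolding Suc by (subst sum.atMost_Suc_shift) simp
  qed
  have "A * S l m = (\<Sum>r\<le>l. \<Sum>s\<le>m. h0 l m r s + h1 l m (Suc r) s + (case s of 0 \<Rightarrow> 0 | Suc s' \<Rightarrow> h2 l m r s'))"
    unfolding S_def sum_distrib_left by (intro sum.cong refl A_term) auto
  also have "\<dots> = (\<Sum>r\<le>l. \<Sum>s\<le>m. h0 l m r s) + (\<Sum>r\<le>l. \<Sum>s\<le>m. h1 l m (Suc r) s)
     + (\<Sum>r\<le>l. \<Sum>s\<le>m. case s of 0 \<Rightarrow> 0 | Suc s' \<Rightarrow> h2 l m r s')"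
    by (simp only: sum.distrib)
  also have "(\<Sum>r\<le>l. \<Sum>s\<le>m. h0 l m r s) = (\<Sum>r\<le>Suc l. \<Sum>s\<le>m. h0 l m r s)"
    by (simp add: h0_def acoef0_def)
  also have "(\<Sum>r\<le>l. \<Sum>s\<le>m. h1 l m (Suc r) s) = (\<Sum>r\<le>Suc l. \<Sum>s\<le>m. h1 l m r s)"
    by (subst sum.atMost_Suc_shift) (simp add: h1_def)
  also have "(\<Sum>r\<le>l. \<Sum>s\<le>m. case s of 0 \<Rightarrow> 0 | Suc s' \<Rightarrow> h2 l m r s') = (\<Sum>r\<le>l. \<Sum>s\<le>m. h2 l m r s)"
    unfolding shift ..
  also have "(\<Sum>r\<le>l. \<Sum>s\<le>m. h2 l m r s) = (\<Sum>r\<le>Suc l. \<Sum>s\<le>m. h2 l m r s)"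
    by (simp add: h2_def acoef0_def)
  finally show ?thesis
    by (simp only: sum.distrib)
qed

text \<open>\<open>V\<close> is a quadratic form in (a, b), and its mixed part is obtained by
  polarization. Three contributions with different (a, b) can thus be added coefficientwise.\<close>

lemma V_expand: "V l m r s a b = a\<^sup>2 *\<^sub>R V l m r s 1 0
   + (a * b) *\<^sub>R (V l m r s 1 1 - V l m r s 1 0 - V l m r s 0 1) + b\<^sup>2 *\<^sub>R V l m r s 0 1"
  by (simp add: V_def T_def algebra_simps power2_eq_square)

lemma h_sum:
  assumes "r \<le> Suc l" "s \<le> m"
  shows "h0 l m r s + h1 l m r s + h2 l m r s =
    ((1 - x * p * p ^ l) / (1 - x * p * p ^ l * p ^ m)) *\<^sub>R ((acoef p x (Suc l) m r s * \<theta> r s) *\<^sub>R V l m r s 1 0)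
    + (x * p * p ^ l * (1 - p ^ m) / (1 - x * p * p ^ l * p ^ m)) *\<^sub>R
       ((acoef0 p x l (m - 1) r s * \<theta> r s) *\<^sub>R V l m r s 0 1)"
proof -
  define R where "R = p ^ r"
  define zz where "zz = z r s"
  define uu where "uu = u l r"
  define vv where "vv = v m s"
  define dd where "dd = 1 - zz * uu * vv"
  define G where "G = acoef p x (Suc l) m r s * ((1 - x * uu * R) / (1 - uu * R))"
  let ?a = "(1 - zz * uu) / dd" and ?b = "zz * uu * (1 - vv) / dd"
  let ?c = "(1 - zz * uu) * (1 - zz * vv) / (dd * (1 - zz))"
  let ?e = "- (zz * (1 - uu) * (1 - vv) / (dd * (1 - zz)))"
  let ?f = "vv / p * (1 - zz * p) / dd"
  let ?w0 = "(1 - uu) / (1 - zz * uu)"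
  let ?w1 = "uu * (1 - R) * (1 - zz) / ((1 - zz * uu) * (1 - zz * vv))"
  let ?g = "zz * uu * (1 - uu) * (1 - vv) * (R - zz) / (1 - zz)"
  let ?k2 = "?g * (p / (vv * (1 - zz * p)))\<^sup>2"
  let ?w2 = "?g * (1 / dd)\<^sup>2"
  have mono: "x * p ^ n \<noteq> 1" for n
    using mult_power_less_one[OF p x, of n] by auto
  have ne: "1 - zz \<noteq> 0" "1 - zz * uu \<noteq> 0" "1 - zz * vv \<noteq> 0" "1 - zz * uu * vv \<noteq> 0" "1 - zz * p \<noteq> 0" "vv \<noteq> 0"
    using p mono[of "r + s"] mono[of "r + s + (Suc l - r)"] mono[of "r + s + (m - s)"]
      mono[of "r + s + (Suc l - r) + (m - s)"] mono[of "Suc (r + s)"]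
    by (simp_all add: zz_def uu_def vv_def z_def u_def v_def power_add mult_ac)
  have Rl: "R * uu = p * p ^ l"
    using assms by (simp add: R_def uu_def u_def flip: power_add power_Suc)
  have Sm: "vv * p ^ s = p ^ m"
    using assms by (simp add: vv_def v_def flip: power_add)
  have e1: "x * p * p ^ l = x * R * uu"
    using Rl by (simp add: mult.assoc)
  have e2: "x * R * uu * p ^ m = zz * uu * vv"
    by (simp add: Sm[symmetric] zz_def z_def R_def)
  note K = acoef0_neighbours[OF p x assms, folded z_def[of r s] u_def[of l r] v_def[of m s] R_def, folded zz_def uu_def vv_def, folded dd_def G_def]
  have d: "d l m r s = dd"
    by (simp add: d_def dd_def zz_def uu_def vv_def)
  \<comment> \<open>Lowering produces the scalar \<open>?f\<close> in each tensor factor; its square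
    cancels the factor kept apart in \<open>acoef0_neighbours\<close> and leaves 1 / d^2.\<close>
  have k2: "?k2 * ?f\<^sup>2 = ?w2"
    using ne p by (simp add: power2_eq_square)
  note I = rational_identities[OF ne(1-4), of R, folded dd_def]
  have comb: "(t * (G * w)) *\<^sub>R V l m r s a b = (t * G) *\<^sub>R ((w * a\<^sup>2) *\<^sub>R V l m r s 1 0
   + (w * (a * b)) *\<^sub>R (V l m r s 1 1 - V l m r s 1 0 - V l m r s 0 1) + (w * b\<^sup>2) *\<^sub>R V l m r s 0 1)" for t w a b
    unfolding V_expand[of l m r s a b] scaleR_add_right scaleR_scaleR by (simp only: mult.assoc)
  have h0: "h0 l m r s = (\<theta> r s * (G * ?w0)) *\<^sub>R V l m r s ?a ?b"
    unfolding h0_def K(1) d by (simp only: zz_def uu_def vv_def)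
  have h1: "h1 l m r s = (\<theta> r s * (G * ?w1)) *\<^sub>R V l m r s ?c ?e"
    unfolding h1_def d using K(2) by (simp only: zz_def uu_def vv_def)
  have h2: "h2 l m r s = (\<theta> r s * (G * ?k2)) *\<^sub>R V l m r s (- ?f) ?f"
    unfolding h2_def d using K(3) by (simp only: zz_def uu_def vv_def R_def mult.assoc)
  have sq: "?k2 * (- ?f)\<^sup>2 = ?w2" "?k2 * (- ?f * ?f) = - ?w2"
    unfolding k2[symmetric] by (simp_all add: power2_eq_square)
  have "h0 l m r s + h1 l m r s + h2 l m r s = (\<theta> r s * G) *\<^sub>R (
     (?w0 * ?a\<^sup>2 + ?w1 * ?c\<^sup>2 + ?w2) *\<^sub>R V l m r s 1 0
     + (?w0 * (?a * ?b) + ?w1 * (?c * ?e) - ?w2) *\<^sub>R (V l m r s 1 1 - V l m r s 1 0 - V l m r s 0 1)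
     + (?w0 * ?b\<^sup>2 + ?w1 * ?e\<^sup>2 + ?w2) *\<^sub>R V l m r s 0 1)"
    unfolding h0 h1 h2 comb sq k2
    by (simp only: scaleR_add_right scaleR_add_left scaleR_diff_left scaleR_minus_left diff_conv_add_uminus add_ac)
  also have "\<dots> = (\<theta> r s * (G * ((1 - uu * R) / dd))) *\<^sub>R V l m r s 1 0
     + (\<theta> r s * (G * (zz * uu * (R - zz * vv) * (1 - uu) * (1 - vv) / ((1 - zz * uu) * (1 - zz * vv) * dd)))) *\<^sub>R V l m r s 0 1"
    unfolding I by (simp only: scaleR_zero_left add_0_right scaleR_add_right scaleR_scaleR mult.assoc)
  also have "\<dots> = (\<theta> r s * ((1 - x * R * uu) / dd * acoef p x (Suc l) m r s)) *\<^sub>R V l m r s 1 0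
     + (\<theta> r s * (x * R * uu * (1 - vv * p ^ s) / dd * acoef0 p x l (m - 1) r s)) *\<^sub>R V l m r s 0 1"
    unfolding K(4,5) ..
  finally show ?thesis
    unfolding e1 e2 Sm dd_def[symmetric] by (simp only: scaleR_scaleR mult_ac)
qed

lemma V_1_0: "V l m r s 1 0 = T r s (XX (r + s) (Suc l - r) (m - s)) (YY (r + s) (Suc l - r) (m - s))"
  by (simp add: V_def)

lemma V_0_1: "V l m r s 0 1 = Q * D * T r s (XX (r + s) (l - r) (m - s - 1)) (YY (r + s) (l - r) (m - s - 1))"
  by (subst mult_T) (auto simp: V_def T_def XX_commute)

lemma S_left: "A * S l m = ((1 - x * p * p ^ l) / (1 - x * p * p ^ l * p ^ m)) *\<^sub>R S (Suc l) m
    + (x * p * p ^ l * (1 - p ^ m) / (1 - x * p * p ^ l * p ^ m)) *\<^sub>R (Q * D * S l (m - 1))"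
proof -
  have 1: "S (Suc l) m = (\<Sum>r\<le>Suc l. \<Sum>s\<le>m. (acoef p x (Suc l) m r s * \<theta> r s) *\<^sub>R V l m r s 1 0)"
    unfolding S_def V_1_0 ..
  have 2: "Q * D * S l (m - 1) = (\<Sum>r\<le>Suc l. \<Sum>s\<le>m. (acoef0 p x l (m - 1) r s * \<theta> r s) *\<^sub>R V l m r s 0 1)" if "m \<noteq> 0"
  proof -
    from that obtain m' where m: "m = Suc m'" by (cases m) auto
    have "Q * D * S l (m - 1) = (\<Sum>r\<le>l. \<Sum>s\<le>m'. (acoef0 p x l m' r s * \<theta> r s) *\<^sub>R V l m r s 0 1)"
      unfolding S_def V_0_1 sum_distrib_left by (intro sum.cong refl) (auto simp: m acoef0_def)
    also have "\<dots> = (\<Sum>r\<le>Suc l. \<Sum>s\<le>m. (acoef0 p x l m' r s * \<theta> r s) *\<^sub>R V l m r s 0 1)"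
      unfolding m by (simp add: acoef0_def)
    finally show ?thesis by (simp add: m)
  qed
  have "A * S l m = (\<Sum>r\<le>Suc l. \<Sum>s\<le>m.
    ((1 - x * p * p ^ l) / (1 - x * p * p ^ l * p ^ m)) *\<^sub>R ((acoef p x (Suc l) m r s * \<theta> r s) *\<^sub>R V l m r s 1 0)
    + (x * p * p ^ l * (1 - p ^ m) / (1 - x * p * p ^ l * p ^ m)) *\<^sub>R
       ((acoef0 p x l (m - 1) r s * \<theta> r s) *\<^sub>R V l m r s 0 1))"
    unfolding A_S by (intro sum.cong refl h_sum) auto
  then have "A * S l m = ((1 - x * p * p ^ l) / (1 - x * p * p ^ l * p ^ m)) *\<^sub>R S (Suc l) m
    + (x * p * p ^ l * (1 - p ^ m) / (1 - x * p * p ^ l * p ^ m)) *\<^sub>R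
       (\<Sum>r\<le>Suc l. \<Sum>s\<le>m. (acoef0 p x l (m - 1) r s * \<theta> r s) *\<^sub>R V l m r s 0 1)"
    unfolding 1 by (simp only: sum.distrib scaleR_sum_right)
  then show ?thesis
    using 2 by (cases "m = 0") auto
qed

end

section \<open>The case l = 0 and the theorem\<close>

lemma acoef_0_0 [simp]:
  assumes "0 < p" "p < 1" "0 < x" "x < 1"
  shows "acoef p x 0 0 0 0 = 1"
proof -
  have "x * p < 1"
    using assms mult_less_one[of x p] by simp
  then show ?thesis
    using assms by (simp add: acoef_def norm_coef_def)
qed

text \<open>For l = 0 the coefficient is p^(s (s + 1 - m)) times the Gaussian binomial coefficient
  of m over s; these are its quotients for m to m + 1 with s kept or raised.\<close>

lemma acoef_0_Suc:
  fixes p x :: real and s k :: nat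
  assumes p: "0 < p" "p < 1" and x: "0 < x" "x < 1"
  shows "acoef p x 0 (Suc (s + k)) 0 s * (p ^ s * (1 - p ^ k * p)) = acoef p x 0 (s + k) 0 s * (1 - p ^ (s + k) * p)"
    and "acoef p x 0 (Suc (s + k)) 0 (Suc s) * (p ^ k * (1 - p ^ s * p)) = acoef p x 0 (s + k) 0 s * (p * (1 - p ^ (s + k) * p))"
proof -
  define z where "z = x * p ^ s"
  define m1 where "m1 = 1 - p ^ (s + k) * p"
  define k1 where "k1 = 1 - p ^ k * p"
  define s1 where "s1 = 1 - p ^ s * p"
  define g where "g = 1 - x * p * p ^ (s + k) * p"
  define g0 where "g0 = 1 - x * p * p ^ (s + k)"
  have mono: "x * p ^ n \<noteq> 1" "p * p ^ n \<noteq> 1" for n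
    using mult_power_less_one[OF p x, of n] mult_power_less_one[OF p p, of n] by auto
  have ne: "g \<noteq> 0" "g0 \<noteq> 0" "m1 \<noteq> 0" "k1 \<noteq> 0" "s1 \<noteq> 0" "1 - z \<noteq> 0" "1 - z * p \<noteq> 0" "1 - z * p * p \<noteq> 0"
    using mono(1)[of "Suc (Suc (s + k))"] mono(1)[of "Suc (s + k)"] mono(1)[of s] mono(1)[of "Suc s"] mono(1)[of "Suc (Suc s)"]
      mono(2)[of "s + k"] mono(2)[of k] mono(2)[of s]
    by (simp_all add: g_def g0_def m1_def k1_def s1_def z_def mult_ac)
  have xp: "0 < x * p" "x * p < 1"
    using p x mult_less_one[of x p] by auto
  have z: "0 < z * p" "z * p < 1"
    using p x mult_power_less_one[OF p xp, of s] by (simp_all add: z_def mult_ac)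
  have e: "1 - z * p * p ^ k = g0" "1 - z * p * p ^ k * p = g" "1 - x * p ^ s = 1 - z" "1 - x * p ^ s * p = 1 - z * p"
    by (simp_all add: z_def g_def g0_def power_add mult_ac)
  define c1 where "c1 = norm_coef p (x * p) 0 (s + k)"
  define c2 where "c2 = norm_coef p (z * p) 0 k"
  define c3 where "c3 = norm_coef p x 0 s"
  have pos: "c1 \<noteq> 0" "c2 \<noteq> 0" "c3 \<noteq> 0" "1 - x * p \<noteq> 0"
    using norm_coef_pos[OF p xp, of 0 "s + k"] norm_coef_pos[OF p z, of 0 k] norm_coef_pos[OF p x, of 0 s] xp
    by (simp_all add: c1_def c2_def c3_def)
  have C1: "norm_coef p (x * p) 0 (Suc (s + k)) = c1 * (x * p * g0 * m1 / (g * g0))"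
    using norm_coef_Suc_right[OF p xp, of 0 "s + k"] by (simp only: c1_def g_def g0_def m1_def power_0 mult_1_right)
  have C2: "norm_coef p (z * p) 0 (Suc k) = c2 * (z * p * g0 * k1 / (g * g0))"
    using norm_coef_Suc_right[OF p z, of 0 k] by (simp only: c2_def e k1_def power_0 mult_1_right)
  have C2s: "norm_coef p (z * p * p) 0 k = c2 * ((1 - z * p * p) * p ^ k * g0 * (1 - z * p) / (g * (1 - z * p) * g0))"
    using norm_coef_shift[OF p z, of 0 k] by (simp only: c2_def e power_0 mult_1_right)
  have C3: "norm_coef p x 0 (Suc s) = c3 * (x * (1 - z) * s1 / ((1 - z * p) * (1 - z)))"
    using norm_coef_Suc_right[OF p x, of 0 s] by (simp only: c3_def e s1_def power_0 mult_1_right)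
  have sub: "s + k - s = k" "Suc (s + k) - s = Suc k" "Suc (s + k) - Suc s = k" "0 - 0 = (0::nat)"
    and zz: "x * p ^ 0 * p ^ s * p = z * p" "x * p ^ 0 * p ^ Suc s * p = z * p * p"
    by (simp_all add: z_def)
  have 0: "acoef p x 0 (s + k) 0 s = (1 - z * p) / (1 - x * p) * c1 / (c2 * c3)"
    unfolding acoef_def sub zz c1_def c2_def c3_def ..
  have 1: "acoef p x 0 (Suc (s + k)) 0 s = (1 - z * p) / (1 - x * p) * (c1 * (x * p * g0 * m1 / (g * g0))) /
      (c2 * (z * p * g0 * k1 / (g * g0)) * c3)"
    unfolding acoef_def sub zz C1 C2 c3_def ..
  have 2: "acoef p x 0 (Suc (s + k)) 0 (Suc s) = (1 - z * p * p) / (1 - x * p) * (c1 * (x * p * g0 * m1 / (g * g0))) /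
      (c2 * ((1 - z * p * p) * p ^ k * g0 * (1 - z * p) / (g * (1 - z * p) * g0)) * (c3 * (x * (1 - z) * s1 / ((1 - z * p) * (1 - z)))))"
    unfolding acoef_def sub zz C1 C2s C3 ..
  have "z = x * p ^ s" by (simp add: z_def)
  then show "acoef p x 0 (Suc (s + k)) 0 s * (p ^ s * (1 - p ^ k * p)) = acoef p x 0 (s + k) 0 s * (1 - p ^ (s + k) * p)"
    unfolding 0 1 k1_def[symmetric] m1_def[symmetric] using ne pos p x by (simp add: field_simps)
  show "acoef p x 0 (Suc (s + k)) 0 (Suc s) * (p ^ k * (1 - p ^ s * p)) = acoef p x 0 (s + k) 0 s * (p * (1 - p ^ (s + k) * p))"
    unfolding 0 2 s1_def[symmetric] m1_def[symmetric] using ne pos p x by (simp add: mult_ac)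
qed

text \<open>A twisted q-Pascal rule. It comes from splitting 1 - p^(m+1) as p^s (1 - p^(m+1-s)) + (1
  - p^s), each part being matched by one of the two quotients.\<close>

lemma acoef0_0_Suc:
  fixes p x :: real and s m :: nat
  assumes p: "0 < p" "p < 1" and x: "0 < x" "x < 1" and s: "s \<le> Suc m"
  shows "acoef0 p x 0 (Suc m) 0 s = acoef0 p x 0 m 0 s + (if s = 0 then 0 else acoef0 p x 0 m 0 (s - 1) * (p / p ^ (Suc m - s)))"
proof -
  define K where "K = acoef p x 0 (Suc m) 0 s"
  have ne: "1 - p ^ m * p \<noteq> 0"
    using p by (rule power_sub_one_neq_0)
  have 1: "acoef0 p x 0 m 0 s * (1 - p ^ m * p) = K * (p ^ s * (1 - p ^ (Suc m - s)))"
  proof (cases "s = Suc m")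
    case False
    then obtain k where "m = s + k" using s by (metis le_SucE nat_le_iff_add)
    then show ?thesis
      using acoef_0_Suc(1)[OF p x, of s k] by (simp add: acoef0_def K_def Suc_diff_le mult.commute)
  qed (simp add: acoef0_def)
  have 2: "(if s = 0 then 0 else acoef0 p x 0 m 0 (s - 1) * (p / p ^ (Suc m - s))) * (1 - p ^ m * p) = K * (1 - p ^ s)"
  proof (cases s)
    case (Suc s')
    then obtain k where m: "m = s' + k" using s by (metis Suc_le_mono nat_le_iff_add)
    show ?thesis
      using acoef_0_Suc(2)[OF p x, of s' k] p by (simp add: acoef0_def K_def Suc m field_simps)
  qed simp
  have "p ^ s * p ^ (Suc m - s) = p ^ m * p"
    using s by (simp flip: power_add add: mult.commute)
  then have "K * (1 - p ^ m * p) = K * (p ^ s * (1 - p ^ (Suc m - s))) + K * (1 - p ^ s)"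
    by (simp add: algebra_simps)
  also have "\<dots> = (acoef0 p x 0 m 0 s + (if s = 0 then 0 else acoef0 p x 0 m 0 (s - 1) * (p / p ^ (Suc m - s)))) * (1 - p ^ m * p)"
    unfolding 1[symmetric] 2[symmetric] by (simp only: distrib_right)
  finally have "K = acoef0 p x 0 m 0 s + (if s = 0 then 0 else acoef0 p x 0 m 0 (s - 1) * (p / p ^ (Suc m - s)))"
    using ne by simp
  then show ?thesis
    using s by (simp add: acoef0_def K_def)
qed

lemma Rdisk_0_left: "Rdisk \<beta> 0 m A B C p = B ^ m"
  by (simp add: Rdisk_le)

context q_disk_pair
begin

lemma T_0:
  "T 0 s (XX n 0 k) (YY n 0 k) = (x2s * y2s) ^ k * (x1s * y1) ^ s"
proof -
  have pow: "(a * b) ^ n = a ^ n * b ^ n" if "b * a = a * b" for a b :: 'a and n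
  proof (induction n)
    case (Suc n)
    have "(a * b) ^ Suc n = a * (b * a ^ n) * b ^ n"
      using Suc by (simp add: mult.assoc)
    also have "b * a ^ n = a ^ n * b"
      using that by (rule power_commute_left)
    finally show ?case
      by (simp add: mult.assoc)
  qed simp
  have yx: "y2s * x2s = x2s * y2s" "y1 * x1s = x1s * y1" "y2s * x1s = x1s * y2s"
    by (auto intro!: xy_commute)
  have "y2s ^ k * x1s ^ s = x1s ^ s * y2s ^ k"
    using yx(3) by (metis power_commuting_commutes)
  then have "(x2s ^ k * x1s ^ s) * (y2s ^ k * y1 ^ s) = (x2s ^ k * y2s ^ k) * (x1s ^ s * y1 ^ s)"
    by (metis mult.assoc)
  then show ?thesis
    unfolding pow[OF yx(1)] pow[OF yx(2)]
    by (simp add: T_def XX_def YY_def M_def N_def Rdisk_0_left)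
qed

text \<open>The induction step of the q-binomial theorem for B = b - q a with b a = p a b. Moving a
  past the power of b and replacing -q \<open>\<theta>\<close> 0 s by p \<open>\<theta>\<close> 0 (s
  + 1) produce the twist in the Pascal rule.\<close>

lemma S_0_Suc: "B * S 0 m = S 0 (Suc m)"
proof -
  define a where "a = x1s * y1"
  define b where "b = x2s * y2s"
  define t where "t k s = b ^ k * a ^ s" for k s
  have ba: "b * a = p *\<^sub>R (a * b)"
  proof -
    have "b * a = (x2s * x1s) * (y2s * y1)"
      unfolding a_def b_def using xy_commute[of x1s y2s] by (metis insertCI mult.assoc)
    also have "\<dots> = p *\<^sub>R ((x1s * x2s) * (y1 * y2s))"
      using X_simps(2) Y_simps(4) by (simp add: p_def power2_eq_square)
    also have "(x1s * x2s) * (y1 * y2s) = a * b"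
      unfolding a_def b_def using xy_commute[of x2s y1] by (metis insertCI mult.assoc)
    finally show ?thesis .
  qed
  have at: "a * t k s = (1 / p ^ k) *\<^sub>R t k (Suc s)" for k s
  proof -
    have "b ^ k * a = p ^ k *\<^sub>R (a * b ^ k)"
      using ba by (rule power_skew_commute)
    then have "a * b ^ k = (1 / p ^ k) *\<^sub>R (b ^ k * a)"
      using p by simp
    then have "a * b ^ k * a ^ s = (1 / p ^ k) *\<^sub>R (b ^ k * a * a ^ s)"
      by simp
    then show ?thesis
      by (simp add: t_def mult.assoc)
  qed
  have bt: "b * t k s = t (Suc k) s" for k s
    by (simp add: t_def mult.assoc)
  have S0: "S 0 n = (\<Sum>s\<le>n. (acoef0 p x 0 n 0 s * \<theta> 0 s) *\<^sub>R t (n - s) s)" for n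
    unfolding S_def t_def a_def b_def by (simp add: T_0 acoef0_def)
  have \<theta>: "- q * \<theta> 0 s = p * \<theta> 0 (Suc s)" for s
  proof -
    have "- q * \<theta> 0 s = - q * (- q * \<theta> 0 (Suc s))"
      by (simp only: \<theta>_Suc_right)
    then show ?thesis
      by (simp add: p_def power2_eq_square)
  qed
  have step: "B * ((acoef0 p x 0 m 0 s * \<theta> 0 s) *\<^sub>R t (m - s) s) =
      (\<theta> 0 s * acoef0 p x 0 m 0 s) *\<^sub>R t (Suc m - s) s
      + (\<theta> 0 (Suc s) * (acoef0 p x 0 m 0 s * (p / p ^ (Suc m - Suc s)))) *\<^sub>R t (Suc m - Suc s) (Suc s)"
    if "s \<le> m" for s
  proof -
    have "B * ((acoef0 p x 0 m 0 s * \<theta> 0 s) *\<^sub>R t (m - s) s) =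
      (\<theta> 0 s * acoef0 p x 0 m 0 s) *\<^sub>R (b * t (m - s) s) + (- q * \<theta> 0 s * acoef0 p x 0 m 0 s) *\<^sub>R (a * t (m - s) s)"
      unfolding B_def a_def[symmetric] b_def[symmetric]
      by (simp add: left_diff_distrib scaleR_diff_right mult.commute)
    then show ?thesis
      unfolding bt at \<theta> using that by (simp add: Suc_diff_le mult_ac)
  qed
  have "B * S 0 m = (\<Sum>s\<le>m. (\<theta> 0 s * acoef0 p x 0 m 0 s) *\<^sub>R t (Suc m - s) s)
      + (\<Sum>s\<le>m. (\<theta> 0 (Suc s) * (acoef0 p x 0 m 0 s * (p / p ^ (Suc m - Suc s)))) *\<^sub>R t (Suc m - Suc s) (Suc s))"
    unfolding S0 sum_distrib_left sum.distrib[symmetric] by (intro sum.cong refl step) auto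
  also have "(\<Sum>s\<le>m. (\<theta> 0 s * acoef0 p x 0 m 0 s) *\<^sub>R t (Suc m - s) s)
     = (\<Sum>s\<le>Suc m. (\<theta> 0 s * acoef0 p x 0 m 0 s) *\<^sub>R t (Suc m - s) s)"
    by (simp add: acoef0_def)
  also have "(\<Sum>s\<le>m. (\<theta> 0 (Suc s) * (acoef0 p x 0 m 0 s * (p / p ^ (Suc m - Suc s)))) *\<^sub>R t (Suc m - Suc s) (Suc s))
     = (\<Sum>s\<le>Suc m. (\<theta> 0 s * (if s = 0 then 0 else acoef0 p x 0 m 0 (s - 1) * (p / p ^ (Suc m - s)))) *\<^sub>R t (Suc m - s) s)"
    by (subst sum.atMost_Suc_shift) simp
  also have "(\<Sum>s\<le>Suc m. (\<theta> 0 s * acoef0 p x 0 m 0 s) *\<^sub>R t (Suc m - s) s) + \<dots> =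
      (\<Sum>s\<le>Suc m. (\<theta> 0 s * acoef0 p x 0 (Suc m) 0 s) *\<^sub>R t (Suc m - s) s)"
    unfolding sum.distrib[symmetric]
    by (intro sum.cong refl) (simp only: acoef0_0_Suc[OF p x] atMost_iff distrib_left scaleR_add_left)
  also have "\<dots> = S 0 (Suc m)"
    unfolding S0 by (simp add: mult.commute)
  finally show ?thesis .
qed

lemma S_0: "S 0 m = B ^ m"
proof (induction m)
  case 0
  show ?case
    using p x by (simp add: S_def \<theta>_def T_def XX_def YY_def M_def N_def)
next
  case (Suc m)
  then show ?case by (simp flip: S_0_Suc)
qed

text \<open>The recurrence also refers to m - 1, so m stays arbitrary. The scalar of the term for l
  + 1 contains 1 - x p^(l+1), which is nonzero, so that term is determined by those for l.\<close>

lemma addition_formula: "Rdisk \<alpha> l m A B (Q * D) p = S l m"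
proof (induction l arbitrary: m)
  case 0
  show ?case by (simp add: Rdisk_0_left S_0)
next
  case (Suc l)
  have "p powr (\<alpha> + 1) = x * p"
    using p_powr[of 0] by simp
  note R = Rdisk_left[OF p _ qdisk_AB, of \<alpha> l m, unfolded this]
  have ne: "x * p * p ^ l \<noteq> 1" "x * p * p ^ l * p ^ m \<noteq> 1"
    using mult_power_less_one[OF p x, of "Suc l"] mult_power_less_one[OF p x, of "Suc (l + m)"]
    by (auto simp: power_add mult.assoc)
  have "A * S l m =
      ((1 - x * p * p ^ l) / (1 - x * p * p ^ l * p ^ m)) *\<^sub>R Rdisk \<alpha> (Suc l) m A B (Q * D) p
      + (x * p * p ^ l * (1 - p ^ m) / (1 - x * p * p ^ l * p ^ m)) *\<^sub>R (Q * D * S l (m - 1))"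
    using R[unfolded Suc.IH] \<alpha> by simp
  then show ?case
    unfolding S_left using ne by simp
qed

end

theorem theorem3p5p8:
  fixes q alpha :: real
    and x1 x1s x2 x2s Q y1 y1s y2 y2s D :: "'a::real_algebra_1"
    and l m :: nat
  assumes q: "0 < q" "q < 1"
    and alpha: "alpha > 0"
    and X: "X_rels q x1 x1s x2 x2s Q"
    and Y: "Y_rels q y1 y1s y2 y2s D"
    and comm: "\<forall>a\<in>{x1, x1s, x2, x2s, Q}. \<forall>b\<in>{y1, y1s, y2, y2s, D}. a * b = b * a"
  shows "Rdisk alpha l m
            (- of_real q * (x1 * y1s) + x2 * y2)
            (- of_real q * (x1s * y1) + x2s * y2s)
            (Q * D) (q^2)
         = (\<Sum>r=0..l. \<Sum>s=0..m.
              of_real (cc4 q alpha l m r s * (- q) powi (int r - int s)) *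
              ((Rdisk (alpha + real r + real s) (l - r) (m - s) x2 x2s Q (q^2)
                * Rdisk (alpha - 1) r s x1 x1s (Q - x2 * x2s) (q^2))
               * (Rdisk (alpha + real r + real s) (l - r) (m - s) y2 y2s D (q^2)
                  * y1 ^ s * y1s ^ r)))"
proof -
  interpret q_disk_pair q alpha x1 x1s x2 x2s Q y1 y1s y2 y2s D
    using assms by unfold_locales
  have AB: "- of_real q * (x1 * y1s) + x2 * y2 = A" "- of_real q * (x1s * y1) + x2s * y2s = B"
    by (simp_all add: A_def B_def scaleR_conv_of_real)
  show ?thesis
    unfolding AB addition_formula[unfolded p_def] S_def atLeast0AtMost scaleR_conv_of_real[symmetric]
    by (simp add: T_def XX_def YY_def M_def N_def W_def p_def x_def \<theta>_def cc4_eq_acoef[OF q(1)] mult.assoc add.assoc)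
qed

end
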